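(* Assume $\lim_{|x|\to0}\frac{|Q(x)|}{|x|}=0$. Let $\Omega\succ0$ ($\Omega\in\mathbb S^{n\times n}$) and $\Delta$ (a real matrix with $s$ rows) be given, and suppose $D_0D_0^\top\preceq\Delta\Delta^\top$. Suppose the following semi-definite program is feasible, and let $P_1\in\mathbb S^{n\times n}$, $Y_1\in\mathbb R^{T\times n}$, $G_2\in\mathbb R^{T\times(S-n)}$, $\epsilon>0$ be a feasible point: minimize $\|X_1G_2\|$ subject to $$Z_0Y_1=\begin{bmatrix}P_1\\ 0_{(S-n)\times n}\end{bmatrix},\qquad Z_0G_2=\begin{bmatrix}0_{n\times(S-n)}\\ I_{S-n}\end{bmatrix},$$ $$\begin{bmatrix}P_1-\Omega&(X_1Y_1)^\top&Y_1^\top\\ X_1Y_1&P_1-\epsilon E\Delta\Delta^\top E^\top&0_{n\times T}\\ Y_1&0_{T\times n}&\epsilon I_T\end{bmatrix}\succ0.$$ Apply $u=KZ(x)$ with $K=U_0\begin{bmatrix}G_1&G_2\end{bmatrix}$, $G_1:=Y_1P_1^{-1}$. Let $\ell(x)$ be the function defined in the context, $\mathcal L:=\{x:\ell(x)<0\}$, and consider the Lyapunov function $V(x):=x^\top P_1^{-1}x$. Then any sub-level set $\mathcal R_\gamma:=\{x:V(x)\le\gamma\}$ of $V$ contained in $\mathcal L\cup\{0\}$ is a positively invariant set for the closed-loop system with $d\equiv0$, namely $x^+=AZ(x)+BKZ(x)$, and defines an estimate of the region of attraction relative to $\overline x=0$.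
   Context: Let $n,m,s,S,T$ be positive integers with $S\ge n$ (blocks of zero size are absent when $S=n$). Consider the discrete-time system $x^+=AZ(x)+Bu+Ed$, with $x\in\mathbb R^n$, $u\in\mathbb R^m$, $d\in\mathbb R^s$ an unknown process disturbance, constant matrices $A\in\mathbb R^{n\times S}$, $B\in\mathbb R^{n\times m}$ (unknown), $E\in\mathbb R^{n\times s}$ (known), and $Z(x)=\begin{bmatrix}x\\ Q(x)\end{bmatrix}$ with known $Q:\mathbb R^n\to\mathbb R^{S-n}$ containing only nonlinear functions. Data: samples satisfying $x(k+1)=AZ(x(k))+Bu(k)+Ed(k)$ for $k=0,\dots,T-1$. Define $U_0=[u(0)\ \cdots\ u(T-1)]$, $X_1=[x(1)\ \cdots\ x(T)]$, $Z_0=[Z(x(0))\ \cdots\ Z(x(T-1))]$, and the unknown matrix $D_0=[d(0)\ \cdots\ d(T-1)]\in\mathbb R^{s\times T}$. With $\underline\Phi:=P_1^{-1}\Omega P_1^{-1}$, define $\ell(x):=-x^\top\underline\Phi x+\ell_1(x)+\ell_2(x)+\ell_3(x)+\ell_4(x)$, where $\ell_1(x):=(2X_1G_1x+X_1G_2Q(x))^\top P_1^{-1}X_1G_2Q(x)$, $\ell_2(x):=\|\Delta\|_2\,|(2X_1G_1x+X_1G_2Q(x))^\top P_1^{-1}E|\,|G_2Q(x)|$, $\ell_3(x):=\|\Delta\|_2\,|2G_1x+G_2Q(x)|\,|E^\top P_1^{-1}X_1G_2Q(x)|$, $\ell_4(x):=\|\Delta\|_2^2\,\|E^\top P_1^{-1}E\|_2\,|2G_1x+G_2Q(x)|\,|G_2Q(x)|$.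 A set $\mathcal S$ is positively invariant for $x^+=f(x)$ if for every $x(0)\in\mathcal S$ the solution satisfies $x(t)\in\mathcal S$ for $t>0$. For an asymptotically stable equilibrium $\overline x$ of $x^+=f(x)$, a set $\mathcal R$ defines a region of attraction relative to $\overline x$ if for every $x(0)\in\mathcal R$ we have $\lim_{t\to\infty}x(t)=\overline x$. $\mathbb S^{n\times n}$: real symmetric matrices; $\succ,\preceq$: (semi)definite order; $|\cdot|$: Euclidean norm; $\|\cdot\|_2$: induced 2-norm; $\|\cdot\|$: any norm.
   Formalization: The formal statement additionally assumes Q(0)=0; the limit of |Q(x)|/|x| as |x|→0 does not force this, and without it 0 need not be an equilibrium of the closed loop, so the claim fails (e.g. Q(x)=x² for x≠0, Q(0)=1). *)

theory Defs
  imports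
    "HOL-Analysis.L2_Norm"
    "Jordan_Normal_Form.Gauss_Jordan_Elimination"
begin

(* Matrices and vectors with explicit carriers are used throughout, because the dimension S - n
   may be 0, which index types cannot express. *)

(* HOL-Analysis has another type constructor called vec. *)
type_synonym rvec = "real vec"

definition euclid_norm :: "rvec \<Rightarrow> real" where
  "euclid_norm v = L2_set (\<lambda>i. v $ i) {..<dim_vec v}"

(* Induced 2-norm. Taking the supremum over the unit ball instead of the unit sphere keeps the set
   nonempty, and the norm equal to 0, for a matrix without columns. *)
definition induced_norm2 :: "real mat \<Rightarrow> real" where
  "induced_norm2 M =
     Sup {euclid_norm (M *\<^sub>v v) |v. v \<in> carrier_vec (dim_col M) \<and> euclid_norm v \<le> 1}"

(* Meaningful for invertible matrices only: mat_inverse returns None otherwise. *)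
definition minv :: "real mat \<Rightarrow> real mat" where
  "minv M = the (mat_inverse M)"

definition sym_mat :: "nat \<Rightarrow> real mat \<Rightarrow> bool" where
  "sym_mat n M \<longleftrightarrow> M \<in> carrier_mat n n \<and> transpose_mat M = M"

definition pos_def :: "nat \<Rightarrow> real mat \<Rightarrow> bool" where
  "pos_def n M \<longleftrightarrow> sym_mat n M \<and>
     (\<forall>v\<in>carrier_vec n. v \<noteq> 0\<^sub>v n \<longrightarrow> 0 < v \<bullet> (M *\<^sub>v v))"

definition pos_semidef :: "nat \<Rightarrow> real mat \<Rightarrow> bool" where
  "pos_semidef n M \<longleftrightarrow> sym_mat n M \<and> (\<forall>v\<in>carrier_vec n. 0 \<le> v \<bullet> (M *\<^sub>v v))"

definition loewner_le :: "nat \<Rightarrow> real mat \<Rightarrow> real mat \<Rightarrow> bool" where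
  "loewner_le n M N \<longleftrightarrow> sym_mat n M \<and> sym_mat n N \<and> pos_semidef n (N - M)"

definition append_cols :: "real mat \<Rightarrow> real mat \<Rightarrow> real mat" where
  "append_cols M N = four_block_mat M N (0\<^sub>m 0 (dim_col M)) (0\<^sub>m 0 (dim_col N))"

(* The solution of x+ = f(x) from x0 at time t is (f ^^ t) x0. *)

definition positively_invariant :: "(rvec \<Rightarrow> rvec) \<Rightarrow> rvec set \<Rightarrow> bool" where
  "positively_invariant f R \<longleftrightarrow> (\<forall>x0\<in>R. \<forall>t>0. (f ^^ t) x0 \<in> R)"

definition solution_tendsto ::
    "(rvec \<Rightarrow> rvec) \<Rightarrow> rvec \<Rightarrow> rvec \<Rightarrow> bool" where
  "solution_tendsto f x0 xbar \<longleftrightarrow>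
     (\<lambda>t. euclid_norm ((f ^^ t) x0 - xbar)) \<longlonglongrightarrow> 0"

definition asymptotically_stable ::
    "nat \<Rightarrow> (rvec \<Rightarrow> rvec) \<Rightarrow> rvec \<Rightarrow> bool" where
  "asymptotically_stable n f xbar \<longleftrightarrow>
     xbar \<in> carrier_vec n \<and> f xbar = xbar \<and>
     (\<forall>e>0. \<exists>r>0. \<forall>x0\<in>carrier_vec n. euclid_norm (x0 - xbar) < r \<longrightarrow>
        (\<forall>t. euclid_norm ((f ^^ t) x0 - xbar) < e)) \<and>
     (\<exists>r>0. \<forall>x0\<in>carrier_vec n. euclid_norm (x0 - xbar) < r \<longrightarrow> solution_tendsto f x0 xbar)"

definition region_of_attraction ::
    "nat \<Rightarrow> (rvec \<Rightarrow> rvec) \<Rightarrow> rvec \<Rightarrow> rvec set \<Rightarrow> bool" where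
  "region_of_attraction n f xbar R \<longleftrightarrow>
     asymptotically_stable n f xbar \<and> R \<subseteq> carrier_vec n \<and> (\<forall>x0\<in>R. solution_tendsto f x0 xbar)"

definition lmi_mat ::
    "nat \<Rightarrow> nat \<Rightarrow> real mat \<Rightarrow> real mat \<Rightarrow> real mat \<Rightarrow> real mat \<Rightarrow>
     real mat \<Rightarrow> real mat \<Rightarrow> real \<Rightarrow> real mat" where
  "lmi_mat n T \<Omega> \<Delta> E X1 P1 Y1 \<epsilon> =
     four_block_mat
       (four_block_mat
          (P1 - \<Omega>)   (transpose_mat (X1 * Y1))
          (X1 * Y1)  (P1 - \<epsilon> \<cdot>\<^sub>m (E * \<Delta> * transpose_mat \<Delta> * transpose_mat E)))
       (transpose_mat Y1 @\<^sub>r 0\<^sub>m n T)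
       (append_cols Y1 (0\<^sub>m T n))
       (\<epsilon> \<cdot>\<^sub>m 1\<^sub>m T)"

definition lyap :: "real mat \<Rightarrow> rvec \<Rightarrow> real" where
  "lyap P1 x = x \<bullet> (minv P1 *\<^sub>v x)"

definition ell1 ::
    "real mat \<Rightarrow> real mat \<Rightarrow> real mat \<Rightarrow> real mat \<Rightarrow> (rvec \<Rightarrow> rvec) \<Rightarrow> rvec \<Rightarrow> real" where
  "ell1 X1 P1 G1 G2 Q x =
     (2 \<cdot>\<^sub>v (X1 *\<^sub>v (G1 *\<^sub>v x)) + X1 *\<^sub>v (G2 *\<^sub>v Q x)) \<bullet> (minv P1 *\<^sub>v (X1 *\<^sub>v (G2 *\<^sub>v Q x)))"

(* The row vector v^T P1^{-1} E is represented by its transpose (P1^{-1} E)^T v. *)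
definition ell2 ::
    "real mat \<Rightarrow> real mat \<Rightarrow> real mat \<Rightarrow> real mat \<Rightarrow> real mat \<Rightarrow> real mat \<Rightarrow>
     (rvec \<Rightarrow> rvec) \<Rightarrow> rvec \<Rightarrow> real" where
  "ell2 \<Delta> E X1 P1 G1 G2 Q x =
     induced_norm2 \<Delta>
     * euclid_norm (transpose_mat (minv P1 * E)
         *\<^sub>v (2 \<cdot>\<^sub>v (X1 *\<^sub>v (G1 *\<^sub>v x)) + X1 *\<^sub>v (G2 *\<^sub>v Q x)))
     * euclid_norm (G2 *\<^sub>v Q x)"

definition ell3 ::
    "real mat \<Rightarrow> real mat \<Rightarrow> real mat \<Rightarrow> real mat \<Rightarrow> real mat \<Rightarrow> real mat \<Rightarrow>
     (rvec \<Rightarrow> rvec) \<Rightarrow> rvec \<Rightarrow> real" where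
  "ell3 \<Delta> E X1 P1 G1 G2 Q x =
     induced_norm2 \<Delta>
     * euclid_norm (2 \<cdot>\<^sub>v (G1 *\<^sub>v x) + G2 *\<^sub>v Q x)
     * euclid_norm (transpose_mat E *\<^sub>v (minv P1 *\<^sub>v (X1 *\<^sub>v (G2 *\<^sub>v Q x))))"

definition ell4 ::
    "real mat \<Rightarrow> real mat \<Rightarrow> real mat \<Rightarrow> real mat \<Rightarrow> real mat \<Rightarrow>
     (rvec \<Rightarrow> rvec) \<Rightarrow> rvec \<Rightarrow> real" where
  "ell4 \<Delta> E P1 G1 G2 Q x =
     (induced_norm2 \<Delta>)\<^sup>2
     * induced_norm2 (transpose_mat E * minv P1 * E)
     * euclid_norm (2 \<cdot>\<^sub>v (G1 *\<^sub>v x) + G2 *\<^sub>v Q x)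
     * euclid_norm (G2 *\<^sub>v Q x)"

definition ell ::
    "real mat \<Rightarrow> real mat \<Rightarrow> real mat \<Rightarrow> real mat \<Rightarrow> real mat \<Rightarrow> real mat \<Rightarrow> real mat \<Rightarrow>
     (rvec \<Rightarrow> rvec) \<Rightarrow> rvec \<Rightarrow> real" where
  "ell \<Omega> \<Delta> E X1 P1 G1 G2 Q x =
     - (x \<bullet> ((minv P1 * \<Omega> * minv P1) *\<^sub>v x))
     + ell1 X1 P1 G1 G2 Q x + ell2 \<Delta> E X1 P1 G1 G2 Q x
     + ell3 \<Delta> E X1 P1 G1 G2 Q x + ell4 \<Delta> E P1 G1 G2 Q x"

end

theory Submission
  imports Defs "Jordan_Normal_Form.Determinant"
begin

text \<open>The constraints \<open>Z\<^sub>0 [G\<^sub>1 G\<^sub>2] = I\<close> turn the closed loop into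
  \<open>x\<^sup>+ = M (G\<^sub>1 x + G\<^sub>2 Q x)\<close> with \<open>M = X\<^sub>1 - E D\<^sub>0\<close>. In \<open>V(x\<^sup>+)\<close>, the part quadratic in
  \<open>M G\<^sub>1 x\<close> is controlled by the LMI and the remaining part, via \<open>\<parallel>D\<^sub>0\<parallel> \<le> \<parallel>\<Delta>\<parallel>\<close>, by
  \<open>\<ell>\<^sub>1 + \<ell>\<^sub>2 + \<ell>\<^sub>3 + \<ell>\<^sub>4\<close>. Because the LMI is strict, this gives \<open>V(x\<^sup>+) \<le> q V(x) + \<ell>(x)\<close> with a
  constant \<open>q < 1\<close>, so \<open>V\<close> decays geometrically on the sublevel set. This margin is
  essential: \<open>Q\<close> need not be continuous away from \<open>0\<close>, so \<open>V(x\<^sup>+) < V(x)\<close> alone would not force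
  convergence. Near \<open>0\<close>, \<open>Q(x) = o(x)\<close> makes \<open>\<ell>\<close> negative, which yields asymptotic stability for
  every \<open>\<gamma>\<close>.\<close>

subsection \<open>Norms and positive definite matrices\<close>

lemma mult_mat_vec_zero:
  fixes M :: "'a :: semiring_0 mat"
  shows "M \<in> carrier_mat r c \<Longrightarrow> M *\<^sub>v 0\<^sub>v c = 0\<^sub>v r"
  by (intro eq_vecI) auto

lemma mult_mat_vec_uminus:
  fixes M :: "'a :: ring mat"
  assumes "M \<in> carrier_mat r c" "v \<in> carrier_vec c"
  shows "M *\<^sub>v (- v) = - (M *\<^sub>v v)"
  using assms by (intro eq_vecI) auto

lemma euclid_norm_power2: "(euclid_norm v)\<^sup>2 = v \<bullet> v"
  by (simp add: euclid_norm_def L2_set_def scalar_prod_def sum_nonneg power2_eq_square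
      lessThan_atLeast0)

lemma euclid_norm_nonneg [simp]: "0 \<le> euclid_norm v"
  by (simp add: euclid_norm_def)

lemma scalar_prod_self_nonneg: "0 \<le> v \<bullet> (v :: rvec)"
  by (metis euclid_norm_power2 zero_le_power2)

lemma euclid_norm_eq_0: "v \<in> carrier_vec n \<Longrightarrow> euclid_norm v = 0 \<longleftrightarrow> v = 0\<^sub>v n"
  by (auto simp: euclid_norm_def L2_set_eq_0_iff)

lemma euclid_norm_smult: "euclid_norm (c \<cdot>\<^sub>v v) = \<bar>c\<bar> * euclid_norm v"
proof (rule power2_eq_imp_eq)
  show "(euclid_norm (c \<cdot>\<^sub>v v))\<^sup>2 = (\<bar>c\<bar> * euclid_norm v)\<^sup>2"
    unfolding power_mult_distrib power2_abs euclid_norm_power2 by (simp add: power2_eq_square)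
qed simp_all

lemma sym_mat_scalar_prod:
  assumes "sym_mat n M" "a \<in> carrier_vec n" "b \<in> carrier_vec n"
  shows "a \<bullet> (M *\<^sub>v b) = b \<bullet> (M *\<^sub>v a)"
  using assms transpose_vec_mult_scalar[of M n n b a] comm_scalar_prod[of "M *\<^sub>v a" n b]
  by (auto simp: sym_mat_def)

text \<open>For \<open>c > 0\<close> evaluate at the minimiser \<open>t = - b / c\<close>. For
  \<open>c = 0\<close> an affine function that is nonnegative everywhere must have slope
  zero.\<close>

lemma quadratic_nonneg_imp_discriminant:
  fixes a b c :: real
  assumes "0 \<le> c" and "\<And>t. 0 \<le> a + 2 * b * t + c * t\<^sup>2"
  shows "b\<^sup>2 \<le> a * c"
proof (cases "c = 0")
  case True
  have "b = 0"
  proof (rule ccontr)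
    assume "b \<noteq> 0"
    \<comment> \<open>At this \<open>t\<close> the affine function takes the value
      \<open>-1\<close>.\<close>
    then show False
      using assms(2)[of "- (a + 1) / (2 * b)"] True by (simp add: field_simps)
  qed
  then show ?thesis using True by simp
next
  case False
  then show ?thesis
    using assms(1) assms(2)[of "- b / c"] by (simp add: field_simps power2_eq_square)
qed

text \<open>Along the line \<open>a + t \<cdot>\<^sub>v b\<close> the form is a nonnegative
  quadratic polynomial in \<open>t\<close>, so the discriminant bound applies. With the identity for
  \<open>M\<close> this becomes the Euclidean inequality.\<close>

lemma pos_semidef_Cauchy_Schwarz:
  assumes M: "pos_semidef n M" and a: "a \<in> carrier_vec n" and b: "b \<in> carrier_vec n"
  shows "(a \<bullet> (M *\<^sub>v b))\<^sup>2 \<le> (a \<bullet> (M *\<^sub>v a)) * (b \<bullet> (M *\<^sub>v b))"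
proof (rule quadratic_nonneg_imp_discriminant)
  show "0 \<le> b \<bullet> (M *\<^sub>v b)" using M b by (simp add: pos_semidef_def)
  fix t :: real
  have Mc: "M \<in> carrier_mat n n" and s: "sym_mat n M"
    using M by (auto simp: pos_semidef_def sym_mat_def)
  have "0 \<le> (a + t \<cdot>\<^sub>v b) \<bullet> (M *\<^sub>v (a + t \<cdot>\<^sub>v b))"
    using M a b by (auto simp: pos_semidef_def)
  also have "\<dots> = a \<bullet> (M *\<^sub>v a) + 2 * (a \<bullet> (M *\<^sub>v b)) * t + (b \<bullet> (M *\<^sub>v b)) * t\<^sup>2"
  proof -
    have "M *\<^sub>v a \<in> carrier_vec n" "M *\<^sub>v b \<in> carrier_vec n" using Mc a b by auto
    then show ?thesis using a b sym_mat_scalar_prod[OF s b a]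
      by (simp add: mult_add_distrib_mat_vec[OF Mc] mult_mat_vec[OF Mc]
          add_scalar_prod_distrib[of _ n] scalar_prod_add_distrib[of _ n]
          power2_eq_square algebra_simps)
  qed
  finally show "0 \<le> a \<bullet> (M *\<^sub>v a) + 2 * (a \<bullet> (M *\<^sub>v b)) * t + (b \<bullet> (M *\<^sub>v b)) * t\<^sup>2" .
qed

lemma pos_def_imp_pos_semidef: "pos_def n M \<Longrightarrow> pos_semidef n M"
  unfolding pos_def_def pos_semidef_def
  by (metis less_eq_real_def mult_mat_vec_carrier scalar_prod_left_zero sym_mat_def)

lemma pos_semidef_one: "pos_semidef n (1\<^sub>m n)"
  by (auto simp: pos_semidef_def sym_mat_def scalar_prod_self_nonneg)

lemma scalar_prod_le_euclid_norm:
  assumes "a \<in> carrier_vec n" "b \<in> carrier_vec n"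
  shows "\<bar>a \<bullet> b\<bar> \<le> euclid_norm a * euclid_norm b"
proof (rule power2_le_imp_le)
  show "\<bar>a \<bullet> b\<bar>\<^sup>2 \<le> (euclid_norm a * euclid_norm b)\<^sup>2"
    using pos_semidef_Cauchy_Schwarz[OF pos_semidef_one assms] assms
    by (simp add: power_mult_distrib euclid_norm_power2)
qed simp

lemma euclid_norm_add_le:
  fixes a b :: rvec
  assumes "a \<in> carrier_vec n" "b \<in> carrier_vec n"
  shows "euclid_norm (a + b) \<le> euclid_norm a + euclid_norm b"
proof -
  have "euclid_norm (a + b) = L2_set (\<lambda>i. a $ i + b $ i) {..<n}"
    using assms by (simp add: euclid_norm_def L2_set_def)
  then show ?thesis
    using assms L2_set_triangle_ineq[of "($) a" "($) b" "{..<n}"] by (simp add: euclid_norm_def)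
qed

section \<open>Operator bounds and the induced norm\<close>

text \<open>Cauchy-Schwarz is applied to each row, and the norm of the result is at most the sum of
  its absolute entries. The bound also makes the supremum in \<open>induced_norm2\<close>
  finite.\<close>

lemma mult_mat_vec_bounded:
  fixes M :: "real mat"
  assumes "M \<in> carrier_mat r c"
  shows "\<exists>C>0. \<forall>v\<in>carrier_vec c. euclid_norm (M *\<^sub>v v) \<le> C * euclid_norm v"
proof (intro exI conjI ballI)
  \<comment> \<open>The summand 1 keeps \<open>C\<close> positive even when every row vanishes, so
    that later proofs may divide by such a constant.\<close>
  define C where "C = 1 + (\<Sum>i<r. euclid_norm (row M i))"
  show "0 < C" unfolding C_def by (intro add_pos_nonneg sum_nonneg) auto
  fix v :: rvec assume v: "v \<in> carrier_vec c"
  have "euclid_norm (M *\<^sub>v v) \<le> (\<Sum>i<r. \<bar>row M i \<bullet> v\<bar>)"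
    using assms L2_set_le_sum_abs[of "\<lambda>i. (M *\<^sub>v v) $ i" "{..<r}"] by (simp add: euclid_norm_def)
  also have "\<dots> \<le> (\<Sum>i<r. euclid_norm (row M i) * euclid_norm v)"
    by (intro sum_mono scalar_prod_le_euclid_norm[of _ c]) (use v assms in auto)
  also have "\<dots> \<le> C * euclid_norm v"
    by (simp add: C_def distrib_right flip: sum_distrib_right)
  finally show "euclid_norm (M *\<^sub>v v) \<le> C * euclid_norm v" .
qed

text \<open>A real supremum is informative only for a set that is bounded above; the bound comes
  from \<open>mult_mat_vec_bounded\<close>.\<close>

lemma induced_norm2_upper:
  assumes M: "M \<in> carrier_mat r c" and v: "v \<in> carrier_vec c" and "euclid_norm v \<le> 1"
  shows "euclid_norm (M *\<^sub>v v) \<le> induced_norm2 M"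
  unfolding induced_norm2_def
proof (rule cSup_upper)
  show "euclid_norm (M *\<^sub>v v) \<in> {euclid_norm (M *\<^sub>v v) |v. v \<in> carrier_vec (dim_col M) \<and> euclid_norm v \<le> 1}"
    using assms by auto
  obtain C where C: "0 < C" "\<And>v. v \<in> carrier_vec c \<Longrightarrow> euclid_norm (M *\<^sub>v v) \<le> C * euclid_norm v"
    using mult_mat_vec_bounded[OF M] by blast
  have "euclid_norm (M *\<^sub>v v) \<le> C" if "v \<in> carrier_vec c" "euclid_norm v \<le> 1" for v
    using order_trans[OF C(2)[OF that(1)] mult_left_mono[OF that(2), of C]] C(1) by simp
  then show "bdd_above {euclid_norm (M *\<^sub>v v) |v. v \<in> carrier_vec (dim_col M) \<and> euclid_norm v \<le> 1}"
    using M by (auto simp: bdd_above_def)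
qed

lemma induced_norm2_nonneg: "0 \<le> induced_norm2 M"
proof -
  have "euclid_norm (0\<^sub>v (dim_col M)) = 0"
    using euclid_norm_eq_0[of "0\<^sub>v (dim_col M)" "dim_col M"] by simp
  then show ?thesis
    using induced_norm2_upper[of M "dim_row M" "dim_col M" "0\<^sub>v (dim_col M)"]
    by (auto intro: order_trans[OF euclid_norm_nonneg])
qed

text \<open>Normalising \<open>v\<close> moves it into the unit ball, and homogeneity restores its
  length. The zero vector cannot be normalised and is treated apart.\<close>

lemma euclid_norm_mult_mat_vec_le:
  assumes M: "M \<in> carrier_mat r c" and v: "v \<in> carrier_vec c"
  shows "euclid_norm (M *\<^sub>v v) \<le> induced_norm2 M * euclid_norm v"
proof (cases "euclid_norm v = 0")
  case True
  then have v0: "v = 0\<^sub>v c" using v by (simp add: euclid_norm_eq_0)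
  obtain C where "\<forall>v\<in>carrier_vec c. euclid_norm (M *\<^sub>v v) \<le> C * euclid_norm v"
    using mult_mat_vec_bounded[OF M] by blast
  then show ?thesis using v True by force
next
  case False
  then have pos: "0 < euclid_norm v" by (simp add: less_le)
  have "euclid_norm (M *\<^sub>v ((1 / euclid_norm v) \<cdot>\<^sub>v v)) \<le> induced_norm2 M"
    using v False by (intro induced_norm2_upper[OF M]) (auto simp: euclid_norm_smult)
  then show ?thesis
    using pos by (simp add: mult_mat_vec[OF M v] euclid_norm_smult field_simps)
qed

text \<open>With \<open>w = M\<^sup>T v\<close>, adjointness gives
  \<open>|w|^2 = v \<bullet> M w \<le> |v| C |w|\<close>, and one factor \<open>|w|\<close> cancels.
  The constant is left arbitrary because \<open>transpose_mat D0\<close> is to be bounded by the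
  norm of \<open>\<Delta>\<close>.\<close>

lemma euclid_norm_transpose_le:
  assumes M: "M \<in> carrier_mat r c" and v: "v \<in> carrier_vec r"
    and bound: "\<And>w. w \<in> carrier_vec c \<Longrightarrow> euclid_norm (M *\<^sub>v w) \<le> C * euclid_norm w"
    and C: "0 \<le> C"
  shows "euclid_norm (transpose_mat M *\<^sub>v v) \<le> C * euclid_norm v"
proof -
  define w where "w = transpose_mat M *\<^sub>v v"
  have w: "w \<in> carrier_vec c" using M v by (simp add: w_def)
  have "(euclid_norm w)\<^sup>2 = v \<bullet> (M *\<^sub>v w)"
    using transpose_vec_mult_scalar[OF M w v] by (simp add: euclid_norm_power2 w_def)
  also have "\<dots> \<le> euclid_norm v * euclid_norm (M *\<^sub>v w)"
    using scalar_prod_le_euclid_norm[OF v, of "M *\<^sub>v w"] M w by auto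
  also have "\<dots> \<le> euclid_norm v * (C * euclid_norm w)"
    by (intro mult_left_mono bound w) simp
  finally have *: "euclid_norm w * euclid_norm w \<le> euclid_norm w * (C * euclid_norm v)"
    by (simp add: power2_eq_square algebra_simps)
  then show ?thesis
    using C unfolding w_def[symmetric] by (cases "euclid_norm w = 0") (auto simp: mult_le_cancel_left less_le)
qed

section \<open>Inverses and coercivity of positive definite matrices\<close>

text \<open>Definiteness makes the kernel trivial, hence the determinant nonzero and
  \<open>mat_inverse\<close> different from \<open>None\<close>; this is what lets
  \<open>minv\<close> stand for the inverse.\<close>

lemma pos_def_inverse:
  assumes M: "pos_def n M"
  shows "minv M \<in> carrier_mat n n" "M * minv M = 1\<^sub>m n" "minv M * M = 1\<^sub>m n"
proof -
  have Mc: "M \<in> carrier_mat n n" using M by (auto simp: pos_def_def sym_mat_def)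
  have "\<not> (\<exists>v. v \<in> carrier_vec n \<and> v \<noteq> 0\<^sub>v n \<and> M *\<^sub>v v = 0\<^sub>v n)"
    using M unfolding pos_def_def by force
  then have "det M \<noteq> 0" using det_0_iff_vec_prod_zero_field[OF Mc] by blast
  then have "mat_inverse M \<noteq> None"
    using det_non_zero_imp_unit[OF Mc, of "()"] mat_inverse(1)[OF Mc, of "()"] by blast
  then have "mat_inverse M = Some (minv M)" by (auto simp: minv_def)
  from mat_inverse(2)[OF Mc this]
  show "minv M \<in> carrier_mat n n" "M * minv M = 1\<^sub>m n" "minv M * M = 1\<^sub>m n" by auto
qed

text \<open>Every \<open>v\<close> is \<open>M w\<close> with \<open>w = minv M *\<^sub>v v\<close>,
  so the form of the inverse at \<open>v\<close> equals the form of \<open>M\<close> at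
  \<open>w\<close>. Writing \<open>N\<close> for the inverse, symmetry follows from
  \<open>N\<^sup>T = N\<^sup>T M N = (M N)\<^sup>T N = N\<close>.\<close>

lemma pos_def_minv:
  assumes M: "pos_def n M"
  shows "pos_def n (minv M)"
proof -
  note inv = pos_def_inverse[OF M]
  have Mc: "M \<in> carrier_mat n n" and Ms: "sym_mat n M"
    using M by (auto simp: pos_def_def sym_mat_def)
  have MN: "M *\<^sub>v (minv M *\<^sub>v v) = v" if "v \<in> carrier_vec n" for v
    using assoc_mult_mat_vec[OF Mc inv(1) that] inv(2) that by simp
  have "transpose_mat (minv M) = transpose_mat (minv M) * (M * minv M)"
    using inv by simp
  also have "\<dots> = transpose_mat (minv M) * M * minv M"
    using inv Mc by simp
  also have "transpose_mat (minv M) * M = transpose_mat (M * minv M)"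
    using transpose_mult[OF Mc inv(1)] Ms by (simp add: sym_mat_def)
  finally have "transpose_mat (minv M) = minv M" using inv by simp
  moreover have "0 < v \<bullet> (minv M *\<^sub>v v)" if v: "v \<in> carrier_vec n" "v \<noteq> 0\<^sub>v n" for v
  proof -
    have c: "minv M *\<^sub>v v \<in> carrier_vec n" using inv(1) v by auto
    have "minv M *\<^sub>v v \<noteq> 0\<^sub>v n" using MN[OF v(1)] v Mc by force
    then have "0 < (minv M *\<^sub>v v) \<bullet> (M *\<^sub>v (minv M *\<^sub>v v))" using M c unfolding pos_def_def by blast
    then show ?thesis using MN[OF v(1)] comm_scalar_prod[OF c v(1)] by simp
  qed
  ultimately show ?thesis using inv(1) by (simp add: pos_def_def sym_mat_def)
qed

text \<open>Compactness of the unit sphere is avoided by applying the Cauchy-Schwarz inequality of the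
  form \<open>M\<close> to \<open>v \<bullet> v = v \<bullet> M (M\<^sup>-\<^sup>1 v)\<close>.\<close>
lemma pos_def_coercive:
  assumes M: "pos_def n M"
  shows "\<exists>c>0. \<forall>v\<in>carrier_vec n. c * (v \<bullet> v) \<le> v \<bullet> (M *\<^sub>v v)"
proof -
  note inv = pos_def_inverse[OF M]
  have Mc: "M \<in> carrier_mat n n" using M by (auto simp: pos_def_def sym_mat_def)
  obtain C where C: "0 < C" "\<And>v. v \<in> carrier_vec n \<Longrightarrow> euclid_norm (minv M *\<^sub>v v) \<le> C * euclid_norm v"
    using mult_mat_vec_bounded[OF inv(1)] by blast
  have "v \<bullet> v \<le> C * (v \<bullet> (M *\<^sub>v v))" if v: "v \<in> carrier_vec n" for v
  proof -
    define w where "w = minv M *\<^sub>v v"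
    have w: "w \<in> carrier_vec n" using inv(1) v by (simp add: w_def)
    have Mw: "M *\<^sub>v w = v"
      using assoc_mult_mat_vec[OF Mc inv(1) v] inv(2) v by (simp add: w_def)
    have 1: "0 \<le> v \<bullet> (M *\<^sub>v v)"
      using pos_def_imp_pos_semidef[OF M] v by (simp add: pos_semidef_def)
    have "(v \<bullet> v) * (v \<bullet> v) \<le> (v \<bullet> (M *\<^sub>v v)) * (w \<bullet> v)"
      using pos_semidef_Cauchy_Schwarz[OF pos_def_imp_pos_semidef[OF M] v w]
      by (simp add: Mw power2_eq_square)
    also have "\<dots> \<le> (v \<bullet> (M *\<^sub>v v)) * (C * (v \<bullet> v))"
    proof (rule mult_left_mono[OF _ 1])
      have "w \<bullet> v \<le> euclid_norm w * euclid_norm v"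
        using scalar_prod_le_euclid_norm[OF w v] by simp
      also have "\<dots> \<le> C * euclid_norm v * euclid_norm v"
        using C(2)[OF v] by (intro mult_right_mono) (simp_all add: w_def)
      finally show "w \<bullet> v \<le> C * (v \<bullet> v)"
        by (simp add: euclid_norm_power2[symmetric] power2_eq_square)
    qed
    finally have "(v \<bullet> v) * (v \<bullet> v) \<le> (v \<bullet> v) * (C * (v \<bullet> (M *\<^sub>v v)))"
      by (simp add: algebra_simps)
    then show ?thesis
      using 1 C(1) scalar_prod_self_nonneg[of v]
      by (cases "v \<bullet> v = 0") (auto simp: mult_le_cancel_left)
  qed
  then have "\<forall>v\<in>carrier_vec n. 1 / C * (v \<bullet> v) \<le> v \<bullet> (M *\<^sub>v v)"
    using C(1) by (auto simp: field_simps)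
  then show ?thesis using C(1) by (meson zero_less_divide_1_iff)
qed

lemma quadratic_form_bounded:
  fixes M :: "real mat"
  assumes "M \<in> carrier_mat n n"
  shows "\<exists>C>0. \<forall>v\<in>carrier_vec n. v \<bullet> (M *\<^sub>v v) \<le> C * (v \<bullet> v)"
proof -
  obtain C where C: "0 < C" "\<And>v. v \<in> carrier_vec n \<Longrightarrow> euclid_norm (M *\<^sub>v v) \<le> C * euclid_norm v"
    using mult_mat_vec_bounded[OF assms] by blast
  have "v \<bullet> (M *\<^sub>v v) \<le> C * (v \<bullet> v)" if v: "v \<in> carrier_vec n" for v
  proof -
    have "v \<bullet> (M *\<^sub>v v) \<le> euclid_norm v * euclid_norm (M *\<^sub>v v)"
      using scalar_prod_le_euclid_norm[OF v, of "M *\<^sub>v v"] assms v by auto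
    also have "\<dots> \<le> euclid_norm v * (C * euclid_norm v)"
      using C(2)[OF v] by (intro mult_left_mono) auto
    finally show ?thesis by (simp add: euclid_norm_power2[symmetric] power2_eq_square algebra_simps)
  qed
  then show ?thesis using C(1) by blast
qed

subsection \<open>The linear matrix inequality\<close>

lemma append_cols_carrier [simp]:
  "M \<in> carrier_mat r c1 \<Longrightarrow> N \<in> carrier_mat r c2 \<Longrightarrow> append_cols M N \<in> carrier_mat r (c1 + c2)"
  using four_block_carrier_mat[of M r c1 "0\<^sub>m 0 c2" 0 c2 N "0\<^sub>m 0 c1"]
  by (simp add: append_cols_def)

text \<open>\<open>append_cols\<close> is a block matrix whose lower blocks have no rows, so the
  product carries a trailing vector of dimension 0 that has to be discarded.\<close>

lemma append_cols_mult_vec: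
  assumes M: "M \<in> carrier_mat r c1" and N: "N \<in> carrier_mat r c2"
    and a: "a \<in> carrier_vec c1" and b: "b \<in> carrier_vec c2"
  shows "append_cols M N *\<^sub>v (a @\<^sub>v b) = M *\<^sub>v a + N *\<^sub>v b"
proof -
  have "append_cols M N *\<^sub>v (a @\<^sub>v b) = (M *\<^sub>v a + N *\<^sub>v b) @\<^sub>v (0\<^sub>m 0 c1 *\<^sub>v a + 0\<^sub>m 0 c2 *\<^sub>v b)"
    unfolding append_cols_def using four_block_mat_mult_vec[OF M N _ _ a b, of "0\<^sub>m 0 c1" 0 "0\<^sub>m 0 c2"] M N
    by simp
  also have "\<dots> = M *\<^sub>v a + N *\<^sub>v b" using M N by (intro eq_vecI) auto
  finally show ?thesis .
qed

text \<open>The block form is expanded once at an arbitrary vector, so that later arguments only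
  substitute particular vectors. The block \<open>E \<Delta> \<Delta>\<^sup>T E\<^sup>T\<close>
  appears as a squared norm, the quantity that the noise bound controls.\<close>

lemma lmi_mat_quadratic_form:
  assumes c: "P1 \<in> carrier_mat n n" "\<Omega> \<in> carrier_mat n n" "\<Delta> \<in> carrier_mat s p" "E \<in> carrier_mat n s"
    "X1 \<in> carrier_mat n T" "Y1 \<in> carrier_mat T n"
    and v: "w \<in> carrier_vec n" "a \<in> carrier_vec n" "b \<in> carrier_vec T"
  shows "((w @\<^sub>v a) @\<^sub>v b) \<bullet> (lmi_mat n T \<Omega> \<Delta> E X1 P1 Y1 \<epsilon> *\<^sub>v ((w @\<^sub>v a) @\<^sub>v b)) =
     w \<bullet> (P1 *\<^sub>v w) - w \<bullet> (\<Omega> *\<^sub>v w) + 2 * (a \<bullet> (X1 *\<^sub>v (Y1 *\<^sub>v w)))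
     + a \<bullet> (P1 *\<^sub>v a)
     - \<epsilon> * ((transpose_mat \<Delta> *\<^sub>v (transpose_mat E *\<^sub>v a)) \<bullet> (transpose_mat \<Delta> *\<^sub>v (transpose_mat E *\<^sub>v a)))
     + 2 * (b \<bullet> (Y1 *\<^sub>v w)) + \<epsilon> * (b \<bullet> b)"
proof -
  define H where "H = E * \<Delta> * transpose_mat \<Delta> * transpose_mat E"
  define XY where "XY = X1 * Y1"
  have H: "H \<in> carrier_mat n n" and XY: "XY \<in> carrier_mat n n"
    using c unfolding H_def XY_def by auto
  have XYw: "XY *\<^sub>v w = X1 *\<^sub>v (Y1 *\<^sub>v w)" using c v by (simp add: XY_def)
  let ?d = "transpose_mat \<Delta> *\<^sub>v (transpose_mat E *\<^sub>v a)"
  have d: "?d \<in> carrier_vec p" "transpose_mat E *\<^sub>v a \<in> carrier_vec s" using c v by auto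
  \<comment> \<open>Associating the fourfold product to the right lets adjointness peel off
    \<open>E\<close> and then \<open>\<Delta>\<close>.\<close>
  have "H *\<^sub>v a = E *\<^sub>v (\<Delta> *\<^sub>v ?d)"
    unfolding H_def using c v d by (simp add: assoc_mult_mat_vec[of _ n p _ s] assoc_mult_mat_vec[of _ n p _ n]
        assoc_mult_mat_vec[of _ n s _ n] assoc_mult_mat_vec[of _ n s _ s] assoc_mult_mat_vec[of _ s p _ s])
  then have "a \<bullet> (H *\<^sub>v a) = a \<bullet> (E *\<^sub>v (\<Delta> *\<^sub>v ?d))" by simp
  also have "\<dots> = (transpose_mat E *\<^sub>v a) \<bullet> (\<Delta> *\<^sub>v ?d)"
    using transpose_vec_mult_scalar[OF c(4) _ v(2), of "\<Delta> *\<^sub>v ?d"] c d by auto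
  also have "\<dots> = ?d \<bullet> ?d"
    using transpose_vec_mult_scalar[OF c(3) d(1) d(2)] by simp
  finally have aHa: "a \<bullet> (H *\<^sub>v a) = ?d \<bullet> ?d" .
  have Ha: "(\<epsilon> \<cdot>\<^sub>m H) *\<^sub>v a = \<epsilon> \<cdot>\<^sub>v (H *\<^sub>v a)"
    using H v by (intro eq_vecI) auto
  have 1: "four_block_mat (P1 - \<Omega>) (transpose_mat XY) XY (P1 - \<epsilon> \<cdot>\<^sub>m H) *\<^sub>v (w @\<^sub>v a)
     = ((P1 - \<Omega>) *\<^sub>v w + transpose_mat XY *\<^sub>v a) @\<^sub>v (XY *\<^sub>v w + (P1 - \<epsilon> \<cdot>\<^sub>m H) *\<^sub>v a)"
    using c v H XY by (intro four_block_mat_mult_vec) auto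
  have 2: "(transpose_mat Y1 @\<^sub>r 0\<^sub>m n T) *\<^sub>v b = (transpose_mat Y1 *\<^sub>v b) @\<^sub>v 0\<^sub>v n"
  proof -
    have "0\<^sub>m n T *\<^sub>v b = 0\<^sub>v n" using v by (intro eq_vecI) auto
    then show ?thesis using mat_mult_append[of "transpose_mat Y1" n T "0\<^sub>m n T" n b] c v by simp
  qed
  have 3: "append_cols Y1 (0\<^sub>m T n) *\<^sub>v (w @\<^sub>v a) = Y1 *\<^sub>v w"
  proof -
    have "0\<^sub>m T n *\<^sub>v a = 0\<^sub>v T" using v by (intro eq_vecI) auto
    then show ?thesis using append_cols_mult_vec[OF c(6) _ v(1,2), of "0\<^sub>m T n"] c v by simp
  qed
  have 4: "(\<epsilon> \<cdot>\<^sub>m 1\<^sub>m T) *\<^sub>v b = \<epsilon> \<cdot>\<^sub>v b" using v by (intro eq_vecI) auto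
  have D: "P1 - \<Omega> \<in> carrier_mat n n" "P1 - \<epsilon> \<cdot>\<^sub>m H \<in> carrier_mat n n"
    using c H by (intro minus_carrier_mat smult_carrier_mat; simp)+
  have cc: "(P1 - \<Omega>) *\<^sub>v w \<in> carrier_vec n" "transpose_mat XY *\<^sub>v a \<in> carrier_vec n"
    "XY *\<^sub>v w \<in> carrier_vec n" "(P1 - \<epsilon> \<cdot>\<^sub>m H) *\<^sub>v a \<in> carrier_vec n"
    "transpose_mat Y1 *\<^sub>v b \<in> carrier_vec n" "Y1 *\<^sub>v w \<in> carrier_vec T"
    "P1 *\<^sub>v w \<in> carrier_vec n" "P1 *\<^sub>v a \<in> carrier_vec n" "\<Omega> *\<^sub>v w \<in> carrier_vec n" "H *\<^sub>v a \<in> carrier_vec n"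
    using c v H XY mult_mat_vec_carrier[OF D(1) v(1)] mult_mat_vec_carrier[OF D(2) v(2)] by auto
  have "lmi_mat n T \<Omega> \<Delta> E X1 P1 Y1 \<epsilon> *\<^sub>v ((w @\<^sub>v a) @\<^sub>v b) =
    ((((P1 - \<Omega>) *\<^sub>v w + transpose_mat XY *\<^sub>v a) @\<^sub>v (XY *\<^sub>v w + (P1 - \<epsilon> \<cdot>\<^sub>m H) *\<^sub>v a))
      + ((transpose_mat Y1 *\<^sub>v b) @\<^sub>v 0\<^sub>v n)) @\<^sub>v (Y1 *\<^sub>v w + \<epsilon> \<cdot>\<^sub>v b)"
    unfolding lmi_mat_def H_def[symmetric] XY_def[symmetric]
    by (subst four_block_mat_mult_vec[of _ "n + n" "n + n" _ T _ T])
       (use c v XY D four_block_carrier_mat[OF D] in \<open>simp_all add: 1 2 3 4\<close>)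
  also have "\<dots> = (((P1 - \<Omega>) *\<^sub>v w + transpose_mat XY *\<^sub>v a + transpose_mat Y1 *\<^sub>v b) @\<^sub>v
      (XY *\<^sub>v w + (P1 - \<epsilon> \<cdot>\<^sub>m H) *\<^sub>v a)) @\<^sub>v (Y1 *\<^sub>v w + \<epsilon> \<cdot>\<^sub>v b)"
    using append_vec_add[of "(P1 - \<Omega>) *\<^sub>v w + transpose_mat XY *\<^sub>v a" n "transpose_mat Y1 *\<^sub>v b"
        "XY *\<^sub>v w + (P1 - \<epsilon> \<cdot>\<^sub>m H) *\<^sub>v a" n "0\<^sub>v n"] cc
    by simp
  finally have lz: "lmi_mat n T \<Omega> \<Delta> E X1 P1 Y1 \<epsilon> *\<^sub>v ((w @\<^sub>v a) @\<^sub>v b) =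
    (((P1 - \<Omega>) *\<^sub>v w + transpose_mat XY *\<^sub>v a + transpose_mat Y1 *\<^sub>v b) @\<^sub>v
      (XY *\<^sub>v w + (P1 - \<epsilon> \<cdot>\<^sub>m H) *\<^sub>v a)) @\<^sub>v (Y1 *\<^sub>v w + \<epsilon> \<cdot>\<^sub>v b)" .
  have "((w @\<^sub>v a) @\<^sub>v b) \<bullet> (lmi_mat n T \<Omega> \<Delta> E X1 P1 Y1 \<epsilon> *\<^sub>v ((w @\<^sub>v a) @\<^sub>v b)) =
    w \<bullet> ((P1 - \<Omega>) *\<^sub>v w + transpose_mat XY *\<^sub>v a + transpose_mat Y1 *\<^sub>v b)
    + a \<bullet> (XY *\<^sub>v w + (P1 - \<epsilon> \<cdot>\<^sub>m H) *\<^sub>v a) + b \<bullet> (Y1 *\<^sub>v w + \<epsilon> \<cdot>\<^sub>v b)"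
    using scalar_prod_append[OF v(1,2), of "(P1 - \<Omega>) *\<^sub>v w + transpose_mat XY *\<^sub>v a + transpose_mat Y1 *\<^sub>v b"
        "XY *\<^sub>v w + (P1 - \<epsilon> \<cdot>\<^sub>m H) *\<^sub>v a"] v cc
    unfolding lz by (subst scalar_prod_append[of _ "n + n" _ T]) simp_all
  also have "\<dots> = w \<bullet> ((P1 - \<Omega>) *\<^sub>v w) + w \<bullet> (transpose_mat XY *\<^sub>v a) + w \<bullet> (transpose_mat Y1 *\<^sub>v b)
    + a \<bullet> (XY *\<^sub>v w) + a \<bullet> ((P1 - \<epsilon> \<cdot>\<^sub>m H) *\<^sub>v a) + b \<bullet> (Y1 *\<^sub>v w) + \<epsilon> * (b \<bullet> b)"
    using v cc by (simp add: scalar_prod_add_distrib[of _ n] scalar_prod_add_distrib[of _ T])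
  also have "w \<bullet> (transpose_mat XY *\<^sub>v a) = a \<bullet> (XY *\<^sub>v w)"
    using transpose_vec_mult_scalar[OF XY v(1,2)] comm_scalar_prod[OF v(1) cc(2)] by simp
  also have "w \<bullet> (transpose_mat Y1 *\<^sub>v b) = b \<bullet> (Y1 *\<^sub>v w)"
    using transpose_vec_mult_scalar[OF c(6) v(1,3)] comm_scalar_prod[OF v(1) cc(5)] by simp
  also have "w \<bullet> ((P1 - \<Omega>) *\<^sub>v w) = w \<bullet> (P1 *\<^sub>v w) - w \<bullet> (\<Omega> *\<^sub>v w)"
    unfolding minus_mult_distrib_mat_vec[OF c(1,2) v(1)]
    by (rule scalar_prod_minus_distrib[OF v(1) cc(7) cc(9)])
  also have "a \<bullet> ((P1 - \<epsilon> \<cdot>\<^sub>m H) *\<^sub>v a) = a \<bullet> (P1 *\<^sub>v a) - \<epsilon> * (?d \<bullet> ?d)"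
    unfolding minus_mult_distrib_mat_vec[OF c(1) smult_carrier_mat[OF H] v(2)] Ha
    using scalar_prod_minus_distrib[OF v(2) cc(8), of "\<epsilon> \<cdot>\<^sub>v (H *\<^sub>v a)"]
      scalar_prod_smult_distrib[OF v(2) cc(10), of \<epsilon>] cc(10) aHa
    by simp
  finally show ?thesis by (simp add: XYw)
qed

text \<open>The leading diagonal block gives \<open>P1 \<succ> \<Omega> \<succ> 0\<close>; padding
  \<open>w\<close> with zero vectors isolates it. Feasibility supplies only the symmetry of
  \<open>P1\<close> directly, and \<open>minv P1\<close> needs more.\<close>

lemma lmi_mat_pos_def_imp_pos_def:
  assumes P1: "sym_mat n P1" and \<Omega>: "pos_def n \<Omega>"
    and c: "\<Delta> \<in> carrier_mat s p" "E \<in> carrier_mat n s" "X1 \<in> carrier_mat n T" "Y1 \<in> carrier_mat T n"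
    and lmi: "pos_def (n + n + T) (lmi_mat n T \<Omega> \<Delta> E X1 P1 Y1 \<epsilon>)"
  shows "pos_def n P1"
  unfolding pos_def_def
proof (intro conjI ballI impI P1)
  fix w :: rvec assume w: "w \<in> carrier_vec n" "w \<noteq> 0\<^sub>v n"
  have c': "P1 \<in> carrier_mat n n" "\<Omega> \<in> carrier_mat n n"
    using P1 \<Omega> by (auto simp: sym_mat_def pos_def_def)
  let ?z = "(w @\<^sub>v 0\<^sub>v n) @\<^sub>v 0\<^sub>v T"
  have "?z \<noteq> 0\<^sub>v (n + n + T)"
  proof
    assume z0: "?z = 0\<^sub>v (n + n + T)"
    have "w $ i = 0" if "i < n" for i
      using arg_cong[OF z0, of "\<lambda>z. z $ i"] that w by simp
    then show False using w by auto
  qed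
  moreover have "?z \<in> carrier_vec (n + n + T)" using w by simp
  ultimately have "0 < ?z \<bullet> (lmi_mat n T \<Omega> \<Delta> E X1 P1 Y1 \<epsilon> *\<^sub>v ?z)"
    using lmi unfolding pos_def_def by blast
  also have "\<dots> = w \<bullet> (P1 *\<^sub>v w) - w \<bullet> (\<Omega> *\<^sub>v w)"
  proof -
    have "X1 *\<^sub>v (Y1 *\<^sub>v w) \<in> carrier_vec n" "Y1 *\<^sub>v w \<in> carrier_vec T" using c w by auto
    then show ?thesis
      using lmi_mat_quadratic_form[OF c' c w(1), of "0\<^sub>v n" "0\<^sub>v T" \<epsilon>] c c'
      by (simp add: mult_mat_vec_zero[of _ n n] mult_mat_vec_zero[of _ s n] mult_mat_vec_zero[of _ p s])
  qed
  finally show "0 < w \<bullet> (P1 *\<^sub>v w)" using \<Omega> w unfolding pos_def_def by force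
qed

text \<open>A Gram form is a squared norm,
  \<open>v \<bullet> M M\<^sup>T v = |M\<^sup>T v|^2\<close>, so the Loewner order of Gram matrices
  is a pointwise comparison of norms.\<close>

lemma loewner_le_gram:
  assumes D: "D \<in> carrier_mat s T" and \<Delta>: "\<Delta> \<in> carrier_mat s p"
    and le: "loewner_le s (D * transpose_mat D) (\<Delta> * transpose_mat \<Delta>)" and v: "v \<in> carrier_vec s"
  shows "euclid_norm (transpose_mat D *\<^sub>v v) \<le> euclid_norm (transpose_mat \<Delta> *\<^sub>v v)"
proof -
  have *: "v \<bullet> ((M * transpose_mat M) *\<^sub>v v) = (euclid_norm (transpose_mat M *\<^sub>v v))\<^sup>2"
    if M: "M \<in> carrier_mat s k" for M :: "real mat" and k
  proof -
    have MT: "transpose_mat M \<in> carrier_mat k s" using M by simp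
    show ?thesis
      unfolding assoc_mult_mat_vec[OF M MT v] euclid_norm_power2
      by (rule transpose_vec_mult_scalar[OF M mult_mat_vec_carrier[OF MT v] v, symmetric])
  qed
  have "0 \<le> v \<bullet> ((\<Delta> * transpose_mat \<Delta> - D * transpose_mat D) *\<^sub>v v)"
    using le v unfolding loewner_le_def pos_semidef_def by blast
  also have "\<dots> = v \<bullet> ((\<Delta> * transpose_mat \<Delta>) *\<^sub>v v) - v \<bullet> ((D * transpose_mat D) *\<^sub>v v)"
  proof -
    have G: "\<Delta> * transpose_mat \<Delta> \<in> carrier_mat s s" and F: "D * transpose_mat D \<in> carrier_mat s s"
      using D \<Delta> by auto
    show ?thesis
      unfolding minus_mult_distrib_mat_vec[OF G F v]
      by (rule scalar_prod_minus_distrib[OF v mult_mat_vec_carrier[OF G v] mult_mat_vec_carrier[OF F v]])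
  qed
  finally show ?thesis
    unfolding *[OF D] *[OF \<Delta>] by (intro power2_le_imp_le[OF _ euclid_norm_nonneg]) simp
qed

text \<open>The quadratic form of the LMI at \<open>(w, - P\<^sub>1\<^sup>-\<^sup>1 y, D\<^sub>0\<^sup>T E\<^sup>T P\<^sub>1\<^sup>-\<^sup>1 y)\<close>, where
  \<open>y = (X\<^sub>1 - E D\<^sub>0) Y\<^sub>1 w\<close>: the cross terms with \<open>D\<^sub>0\<close> cancel and the terms with \<open>\<epsilon>\<close> have a
  nonpositive sum. The strictness of the LMI leaves the margin \<open>\<delta>\<close>.\<close>
lemma lmi_mat_imp_decrease:
  assumes P1: "pos_def n P1" and \<Omega>: "\<Omega> \<in> carrier_mat n n"
    and c: "\<Delta> \<in> carrier_mat s p" "E \<in> carrier_mat n s" "X1 \<in> carrier_mat n T" "Y1 \<in> carrier_mat T n"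
    and D0: "D0 \<in> carrier_mat s T"
    and noise: "loewner_le s (D0 * transpose_mat D0) (\<Delta> * transpose_mat \<Delta>)"
    and eps: "0 < \<epsilon>"
    and lmi: "pos_def (n + n + T) (lmi_mat n T \<Omega> \<Delta> E X1 P1 Y1 \<epsilon>)"
  shows "\<exists>\<delta>>0. \<forall>w\<in>carrier_vec n.
    lyap P1 ((X1 - E * D0) *\<^sub>v (Y1 *\<^sub>v w)) \<le> w \<bullet> (P1 *\<^sub>v w) - w \<bullet> (\<Omega> *\<^sub>v w) - \<delta> * (w \<bullet> w)"
proof -
  \<comment> \<open>Coercivity on the whole space of dimension \<open>n + n + T\<close> turns the
    strict LMI into a margin that is uniform in \<open>w\<close>.\<close>
  obtain \<delta> where \<delta>: "0 < \<delta>" "\<And>z. z \<in> carrier_vec (n + n + T) \<Longrightarrow>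
      \<delta> * (z \<bullet> z) \<le> z \<bullet> (lmi_mat n T \<Omega> \<Delta> E X1 P1 Y1 \<epsilon> *\<^sub>v z)"
    using pos_def_coercive[OF lmi] by blast
  have P1c: "P1 \<in> carrier_mat n n" using P1 by (simp add: pos_def_def sym_mat_def)
  note inv = pos_def_inverse[OF P1]
  have "lyap P1 ((X1 - E * D0) *\<^sub>v (Y1 *\<^sub>v w)) \<le> w \<bullet> (P1 *\<^sub>v w) - w \<bullet> (\<Omega> *\<^sub>v w) - \<delta> * (w \<bullet> w)"
    if w: "w \<in> carrier_vec n" for w
  proof -
    define g where "g = Y1 *\<^sub>v w"
    define y where "y = (X1 - E * D0) *\<^sub>v g"
    define r where "r = minv P1 *\<^sub>v y"
    define a where "a = - r"
    define b where "b = transpose_mat D0 *\<^sub>v (transpose_mat E *\<^sub>v r)"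
    have g: "g \<in> carrier_vec T" using c w by (simp add: g_def)
    have y: "y \<in> carrier_vec n" using c D0 g unfolding y_def
      by (intro mult_mat_vec_carrier[of _ n T] minus_carrier_mat mult_carrier_mat[of _ n s])
    have r: "r \<in> carrier_vec n" using inv y by (simp add: r_def)
    have a: "a \<in> carrier_vec n" using r by (simp add: a_def)
    have Er: "transpose_mat E *\<^sub>v r \<in> carrier_vec s" using c r by auto
    have b: "b \<in> carrier_vec T" using D0 Er by (auto simp: b_def)
    have P1r: "P1 *\<^sub>v r = y"
      using assoc_mult_mat_vec[OF P1c inv(1) y] inv(2) y by (simp add: r_def)
    have X1g: "X1 *\<^sub>v g \<in> carrier_vec n" and Dg: "D0 *\<^sub>v g \<in> carrier_vec s"
      and EDg: "E *\<^sub>v (D0 *\<^sub>v g) \<in> carrier_vec n"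
      using c D0 g by auto
    have "y = X1 *\<^sub>v g - E *\<^sub>v (D0 *\<^sub>v g)"
      using minus_mult_distrib_mat_vec[OF c(3), of "E * D0" g] c(2) D0 g by (simp add: y_def)
    \<comment> \<open>Adjointness moves \<open>E\<close> and then \<open>D0\<close> onto
      \<open>r\<close>, so the unknown contribution becomes \<open>b \<bullet> g\<close>; this is
      why \<open>b\<close> has its form.\<close>
    then have "r \<bullet> y = r \<bullet> (X1 *\<^sub>v g) - r \<bullet> (E *\<^sub>v (D0 *\<^sub>v g))"
      using r X1g EDg by (simp add: scalar_prod_minus_distrib[of _ n])
    also have "r \<bullet> (E *\<^sub>v (D0 *\<^sub>v g)) = (transpose_mat E *\<^sub>v r) \<bullet> (D0 *\<^sub>v g)"
      using transpose_vec_mult_scalar[OF c(2) Dg r] by simp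
    also have "\<dots> = b \<bullet> g"
      using transpose_vec_mult_scalar[OF D0 g Er] by (simp add: b_def)
    finally have rX: "r \<bullet> (X1 *\<^sub>v g) = r \<bullet> y + b \<bullet> g" by simp
    have P1a: "P1 *\<^sub>v a = - y"
      using mult_mat_vec_uminus[OF P1c r] by (simp add: a_def P1r)
    have "b \<bullet> b \<le> (transpose_mat \<Delta> *\<^sub>v (transpose_mat E *\<^sub>v r)) \<bullet> (transpose_mat \<Delta> *\<^sub>v (transpose_mat E *\<^sub>v r))"
      using power_mono[OF loewner_le_gram[OF D0 c(1) noise Er], of 2]
      by (simp add: b_def euclid_norm_power2)
    also have "\<dots> = (transpose_mat \<Delta> *\<^sub>v (transpose_mat E *\<^sub>v a)) \<bullet> (transpose_mat \<Delta> *\<^sub>v (transpose_mat E *\<^sub>v a))"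
      using mult_mat_vec_uminus[of "transpose_mat E" s n r] c(2) r
        mult_mat_vec_uminus[of "transpose_mat \<Delta>" p s "transpose_mat E *\<^sub>v r"] c(1) Er
      by (simp add: a_def)
    finally have bb: "\<epsilon> * (b \<bullet> b) \<le>
        \<epsilon> * ((transpose_mat \<Delta> *\<^sub>v (transpose_mat E *\<^sub>v a)) \<bullet> (transpose_mat \<Delta> *\<^sub>v (transpose_mat E *\<^sub>v a)))"
      using eps by simp
    let ?z = "(w @\<^sub>v a) @\<^sub>v b"
    have zz: "?z \<bullet> ?z = w \<bullet> w + a \<bullet> a + b \<bullet> b"
      using scalar_prod_append[of "w @\<^sub>v a" "n + n" b T "w @\<^sub>v a" b]
        scalar_prod_append[of w n a n w a] w a b by simp
    \<comment> \<open>Only the component \<open>w\<close> of the margin is kept; the squares of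
      \<open>a\<close> and \<open>b\<close> are nonnegative.\<close>
    have "\<delta> * (w \<bullet> w) \<le> \<delta> * (?z \<bullet> ?z)"
      using \<delta>(1) scalar_prod_self_nonneg[of a] scalar_prod_self_nonneg[of b]
      by (intro mult_left_mono) (simp_all add: zz)
    also have "\<dots> \<le> ?z \<bullet> (lmi_mat n T \<Omega> \<Delta> E X1 P1 Y1 \<epsilon> *\<^sub>v ?z)"
      using \<delta>(2)[of ?z] w a b by simp
    also have "\<dots> \<le> w \<bullet> (P1 *\<^sub>v w) - w \<bullet> (\<Omega> *\<^sub>v w) + 2 * (a \<bullet> (X1 *\<^sub>v g)) + a \<bullet> (P1 *\<^sub>v a) + 2 * (b \<bullet> g)"
      using lmi_mat_quadratic_form[OF P1c \<Omega> c w a b, of \<epsilon>] bb by (simp add: g_def)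
    \<comment> \<open>After both substitutions the last three terms sum to \<open>2 (- r \<bullet> y
      - b \<bullet> g) + r \<bullet> y + 2 (b \<bullet> g) = - r \<bullet> y\<close>, and
      \<open>r \<bullet> y\<close> is the Lyapunov value at \<open>y\<close>.\<close>
    also have "a \<bullet> (X1 *\<^sub>v g) = - (r \<bullet> y) - b \<bullet> g"
      using rX uminus_scalar_prod[OF r X1g] by (simp add: a_def)
    also have "a \<bullet> (P1 *\<^sub>v a) = r \<bullet> y"
      using r y unfolding P1a by (simp add: a_def)
    finally have "r \<bullet> y \<le> w \<bullet> (P1 *\<^sub>v w) - w \<bullet> (\<Omega> *\<^sub>v w) - \<delta> * (w \<bullet> w)" by simp
    moreover have "lyap P1 y = r \<bullet> y"
      using comm_scalar_prod[OF y r] by (simp add: lyap_def r_def)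
    ultimately show ?thesis by (simp add: y_def g_def)
  qed
  then show ?thesis using \<delta>(1) by blast
qed

subsection \<open>The closed loop\<close>

lemma data_matrix_equation:
  assumes A: "A \<in> carrier_mat n S" and B: "B \<in> carrier_mat n m" and E: "E \<in> carrier_mat n s"
    and z: "\<And>k. k < T \<Longrightarrow> z k \<in> carrier_vec S" and u: "\<And>k. k < T \<Longrightarrow> u k \<in> carrier_vec m"
    and d: "\<And>k. k < T \<Longrightarrow> d k \<in> carrier_vec s"
    and data: "\<And>k. k < T \<Longrightarrow> y k = A *\<^sub>v z k + B *\<^sub>v u k + E *\<^sub>v d k"
  shows "mat_of_cols n (map y [0..<T]) = A * mat_of_cols S (map z [0..<T])
    + B * mat_of_cols m (map u [0..<T]) + E * mat_of_cols s (map d [0..<T])"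
proof (rule eq_matI)
  fix i j
  assume "i < dim_row (A * mat_of_cols S (map z [0..<T]) + B * mat_of_cols m (map u [0..<T])
      + E * mat_of_cols s (map d [0..<T]))"
    "j < dim_col (A * mat_of_cols S (map z [0..<T]) + B * mat_of_cols m (map u [0..<T])
      + E * mat_of_cols s (map d [0..<T]))"
  then have ij: "i < n" "j < T" using E by auto
  then show "mat_of_cols n (map y [0..<T]) $$ (i, j) = (A * mat_of_cols S (map z [0..<T])
    + B * mat_of_cols m (map u [0..<T]) + E * mat_of_cols s (map d [0..<T])) $$ (i, j)"
    using A B E z[OF ij(2)] u[OF ij(2)] d[OF ij(2)]
    by (simp add: mat_of_cols_index data[OF ij(2)])
qed (use A B E in auto)

text \<open>Since \<open>Z\<^sub>0 [G\<^sub>1 G\<^sub>2] = I\<close>, the closed-loop matrix is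
  \<open>A + B K = (A Z\<^sub>0 + B U\<^sub>0) [G\<^sub>1 G\<^sub>2] = (X\<^sub>1 - E D\<^sub>0) [G\<^sub>1 G\<^sub>2]\<close>.\<close>
lemma closed_loop_eq:
  fixes A B E P1 Y1 G2 U0 Z0 X1 D0 :: "real mat"
  assumes A: "A \<in> carrier_mat n (n + r)" and B: "B \<in> carrier_mat n m" and E: "E \<in> carrier_mat n s"
    and U0: "U0 \<in> carrier_mat m T" and Z0: "Z0 \<in> carrier_mat (n + r) T" and D0: "D0 \<in> carrier_mat s T"
    and X1: "X1 = A * Z0 + B * U0 + E * D0"
    and P1: "pos_def n P1" and Y1: "Y1 \<in> carrier_mat T n" and G2: "G2 \<in> carrier_mat T r"
    and sdp1: "Z0 * Y1 = P1 @\<^sub>r 0\<^sub>m r n" and sdp2: "Z0 * G2 = 0\<^sub>m n r @\<^sub>r 1\<^sub>m r"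
    and v: "v \<in> carrier_vec n" and q: "q \<in> carrier_vec r"
  shows "A *\<^sub>v (v @\<^sub>v q) + B *\<^sub>v ((U0 * append_cols (Y1 * minv P1) G2) *\<^sub>v (v @\<^sub>v q))
    = (X1 - E * D0) *\<^sub>v ((Y1 * minv P1) *\<^sub>v v + G2 *\<^sub>v q)"
proof -
  note inv = pos_def_inverse[OF P1]
  have P1c: "P1 \<in> carrier_mat n n" using P1 by (simp add: pos_def_def sym_mat_def)
  define w where "w = minv P1 *\<^sub>v v"
  have w: "w \<in> carrier_vec n" using inv v by (simp add: w_def)
  have P1w: "P1 *\<^sub>v w = v"
    using assoc_mult_mat_vec[OF P1c inv(1) v] inv(2) v by (simp add: w_def)
  have G1v: "(Y1 * minv P1) *\<^sub>v v = Y1 *\<^sub>v w"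
    using assoc_mult_mat_vec[OF Y1 inv(1) v] by (simp add: w_def)
  have G1: "Y1 * minv P1 \<in> carrier_mat T n" using Y1 inv by simp
  have g1: "Y1 *\<^sub>v w \<in> carrier_vec T" and g2: "G2 *\<^sub>v q \<in> carrier_vec T"
    using mult_mat_vec_carrier[OF Y1 w] mult_mat_vec_carrier[OF G2 q] .
  define g where "g = Y1 *\<^sub>v w + G2 *\<^sub>v q"
  have g: "g \<in> carrier_vec T" using g1 g2 by (simp add: g_def)
  have "0\<^sub>m r n *\<^sub>v w = 0\<^sub>v r" "0\<^sub>m n r *\<^sub>v q = 0\<^sub>v n"
    using w q by (auto intro!: eq_vecI)
  \<comment> \<open>The choice \<open>w = P1\<^sup>-\<^sup>1 v\<close> cancels the block
    \<open>P1\<close> of \<open>Z0 * Y1\<close>, while \<open>q\<close> passes through the identity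
    block of \<open>Z0 * G2\<close>.\<close>
  then have "Z0 *\<^sub>v (Y1 *\<^sub>v w) = v @\<^sub>v 0\<^sub>v r" "Z0 *\<^sub>v (G2 *\<^sub>v q) = 0\<^sub>v n @\<^sub>v q"
    using assoc_mult_mat_vec[OF Z0 Y1 w] assoc_mult_mat_vec[OF Z0 G2 q]
      mat_mult_append[OF P1c zero_carrier_mat w] mat_mult_append[OF zero_carrier_mat one_carrier_mat q]
      q by (simp_all add: sdp1 sdp2 P1w)
  then have Zg: "Z0 *\<^sub>v g = v @\<^sub>v q"
    using mult_add_distrib_mat_vec[OF Z0 g1 g2] append_vec_add[of v n "0\<^sub>v n" "0\<^sub>v r" r q] v q
    by (simp add: g_def)
  have AC: "append_cols (Y1 * minv P1) G2 \<in> carrier_mat T (n + r)" using G1 G2 by simp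
  have vq: "v @\<^sub>v q \<in> carrier_vec (n + r)" using v q by simp
  have "(U0 * append_cols (Y1 * minv P1) G2) *\<^sub>v (v @\<^sub>v q) = U0 *\<^sub>v g"
    using assoc_mult_mat_vec[OF U0 AC vq] append_cols_mult_vec[OF G1 G2 v q] by (simp add: g_def G1v)
  then have "A *\<^sub>v (v @\<^sub>v q) + B *\<^sub>v ((U0 * append_cols (Y1 * minv P1) G2) *\<^sub>v (v @\<^sub>v q))
    = (A * Z0) *\<^sub>v g + (B * U0) *\<^sub>v g"
    using assoc_mult_mat_vec[OF A Z0 g] assoc_mult_mat_vec[OF B U0 g] by (simp add: Zg)
  also have "\<dots> = (A * Z0 + B * U0) *\<^sub>v g"
    using add_mult_distrib_mat_vec[OF mult_carrier_mat[OF A Z0] mult_carrier_mat[OF B U0] g] by simp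
  also have "A * Z0 + B * U0 = X1 - E * D0"
    unfolding X1 using A B E U0 D0 by (intro eq_matI) auto
  finally show ?thesis by (simp add: g_def G1v)
qed

section \<open>Comparison of the closed-loop Lyapunov value with \<open>ell\<close>\<close>

text \<open>With \<open>y = M g1\<close> and \<open>z = M g2\<close>, symmetry makes the form at
  \<open>y + z\<close> equal to the form at \<open>y\<close> plus
  \<open>(2 y + z) \<bullet> P z\<close>, where \<open>2 y + z = M h\<close>. Expanding
  \<open>M = X1 - E D0\<close> on both sides of the last product gives one term free of
  \<open>D0\<close>, two linear in it and one quadratic; they lead to \<open>ell1\<close> through
  \<open>ell4\<close>.\<close>

lemma quadratic_form_perturbation:
  assumes P: "sym_mat n P" and X1: "X1 \<in> carrier_mat n T" and E: "E \<in> carrier_mat n s"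
    and D0: "D0 \<in> carrier_mat s T" and g: "g1 \<in> carrier_vec T" "g2 \<in> carrier_vec T"
    and nd: "0 \<le> nd" "\<And>v. v \<in> carrier_vec T \<Longrightarrow> euclid_norm (D0 *\<^sub>v v) \<le> nd * euclid_norm v"
  defines "M \<equiv> X1 - E * D0" and "h \<equiv> 2 \<cdot>\<^sub>v g1 + g2"
  shows "(M *\<^sub>v (g1 + g2)) \<bullet> (P *\<^sub>v (M *\<^sub>v (g1 + g2))) \<le> (M *\<^sub>v g1) \<bullet> (P *\<^sub>v (M *\<^sub>v g1))
    + (X1 *\<^sub>v h) \<bullet> (P *\<^sub>v (X1 *\<^sub>v g2))
    + nd * euclid_norm (transpose_mat (P * E) *\<^sub>v (X1 *\<^sub>v h)) * euclid_norm g2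
    + nd * euclid_norm h * euclid_norm (transpose_mat E *\<^sub>v (P *\<^sub>v (X1 *\<^sub>v g2)))
    + nd\<^sup>2 * induced_norm2 (transpose_mat E * P * E) * euclid_norm h * euclid_norm g2"
proof -
  have Pc: "P \<in> carrier_mat n n" using P by (simp add: sym_mat_def)
  have ED: "E * D0 \<in> carrier_mat n T" using E D0 by simp
  have M: "M \<in> carrier_mat n T" unfolding M_def by (rule minus_carrier_mat[OF ED])
  have h: "h \<in> carrier_vec T" using g by (simp add: h_def)
  define y where "y = M *\<^sub>v g1"
  define z where "z = M *\<^sub>v g2"
  have yz: "y \<in> carrier_vec n" "z \<in> carrier_vec n"
    unfolding y_def z_def by (rule mult_mat_vec_carrier[OF M g(1)], rule mult_mat_vec_carrier[OF M g(2)])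
  have Pyz: "P *\<^sub>v y \<in> carrier_vec n" "P *\<^sub>v z \<in> carrier_vec n"
    by (rule mult_mat_vec_carrier[OF Pc yz(1)], rule mult_mat_vec_carrier[OF Pc yz(2)])
  have Mh: "M *\<^sub>v h = 2 \<cdot>\<^sub>v y + z"
    using g mult_add_distrib_mat_vec[OF M, of "2 \<cdot>\<^sub>v g1" g2] mult_mat_vec[OF M g(1), of 2]
    by (simp add: h_def y_def z_def)
  have "(M *\<^sub>v (g1 + g2)) \<bullet> (P *\<^sub>v (M *\<^sub>v (g1 + g2))) = (y + z) \<bullet> (P *\<^sub>v y + P *\<^sub>v z)"
    using mult_add_distrib_mat_vec[OF M g] mult_add_distrib_mat_vec[OF Pc yz] by (simp add: y_def z_def)
  also have "\<dots> = y \<bullet> (P *\<^sub>v y) + (2 \<cdot>\<^sub>v y + z) \<bullet> (P *\<^sub>v z)"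
    using yz Pyz sym_mat_scalar_prod[OF P yz]
    by (simp add: add_scalar_prod_distrib[of _ n] scalar_prod_add_distrib[of _ n])
  finally have 1: "(M *\<^sub>v (g1 + g2)) \<bullet> (P *\<^sub>v (M *\<^sub>v (g1 + g2))) = y \<bullet> (P *\<^sub>v y) + (M *\<^sub>v h) \<bullet> (P *\<^sub>v z)"
    by (simp add: Mh)
  define a where "a = X1 *\<^sub>v h"
  define c where "c = X1 *\<^sub>v g2"
  define b where "b = D0 *\<^sub>v h"
  define e where "e = D0 *\<^sub>v g2"
  have abce: "a \<in> carrier_vec n" "c \<in> carrier_vec n" "b \<in> carrier_vec s" "e \<in> carrier_vec s"
    unfolding a_def b_def c_def e_def
    by (rule mult_mat_vec_carrier[OF X1 h], rule mult_mat_vec_carrier[OF X1 g(2)],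
        rule mult_mat_vec_carrier[OF D0 h], rule mult_mat_vec_carrier[OF D0 g(2)])
  have Eb: "E *\<^sub>v b \<in> carrier_vec n" "E *\<^sub>v e \<in> carrier_vec n"
    by (rule mult_mat_vec_carrier[OF E abce(3)], rule mult_mat_vec_carrier[OF E abce(4)])
  have Pc': "P *\<^sub>v c \<in> carrier_vec n" "P *\<^sub>v (E *\<^sub>v e) \<in> carrier_vec n"
    by (rule mult_mat_vec_carrier[OF Pc abce(2)], rule mult_mat_vec_carrier[OF Pc Eb(2)])
  have Mh': "M *\<^sub>v h = a - E *\<^sub>v b" and z': "z = c - E *\<^sub>v e"
    using minus_mult_distrib_mat_vec[OF X1 ED] assoc_mult_mat_vec[OF E D0] h g(2)
    by (simp_all add: M_def z_def a_def b_def c_def e_def)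
  have nb: "euclid_norm b \<le> nd * euclid_norm h" "euclid_norm e \<le> nd * euclid_norm g2"
    using nd(2) h g by (simp_all add: b_def e_def)
  have "(M *\<^sub>v h) \<bullet> (P *\<^sub>v z) = a \<bullet> (P *\<^sub>v c) - a \<bullet> (P *\<^sub>v (E *\<^sub>v e))
      - (E *\<^sub>v b) \<bullet> (P *\<^sub>v c) + (E *\<^sub>v b) \<bullet> (P *\<^sub>v (E *\<^sub>v e))"
    unfolding Mh' z' mult_minus_distrib_mat_vec[OF Pc abce(2) Eb(2)]
    using abce Eb Pc'
    by (simp add: minus_scalar_prod_distrib[of _ n] scalar_prod_minus_distrib[of _ n])
  also have "a \<bullet> (P *\<^sub>v (E *\<^sub>v e)) = (transpose_mat (P * E) *\<^sub>v a) \<bullet> e"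
    using transpose_vec_mult_scalar[OF mult_carrier_mat[OF Pc E] abce(4,1)] assoc_mult_mat_vec[OF Pc E abce(4)]
    by simp
  also have "(E *\<^sub>v b) \<bullet> (P *\<^sub>v c) = (transpose_mat E *\<^sub>v (P *\<^sub>v c)) \<bullet> b"
    using transpose_vec_mult_scalar[OF E abce(3) Pc'(1)] comm_scalar_prod[OF Eb(1) Pc'(1)] by simp
  also have "(E *\<^sub>v b) \<bullet> (P *\<^sub>v (E *\<^sub>v e)) = b \<bullet> ((transpose_mat E * P * E) *\<^sub>v e)"
  proof -
    have ET: "transpose_mat E \<in> carrier_mat s n" using E by simp
    have "(transpose_mat E * P * E) *\<^sub>v e = transpose_mat E *\<^sub>v (P *\<^sub>v (E *\<^sub>v e))"
      using assoc_mult_mat_vec[OF mult_carrier_mat[OF ET Pc] E abce(4)] assoc_mult_mat_vec[OF ET Pc Eb(2)] by simp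
    moreover have "(transpose_mat E *\<^sub>v (P *\<^sub>v (E *\<^sub>v e))) \<bullet> b = (P *\<^sub>v (E *\<^sub>v e)) \<bullet> (E *\<^sub>v b)"
      by (rule transpose_vec_mult_scalar[OF E abce(3) Pc'(2)])
    ultimately show ?thesis
      using comm_scalar_prod[OF Eb(1) Pc'(2)]
        comm_scalar_prod[OF abce(3) mult_mat_vec_carrier[OF ET Pc'(2)]] by simp
  qed
  finally have 2: "(M *\<^sub>v h) \<bullet> (P *\<^sub>v z) = a \<bullet> (P *\<^sub>v c) - (transpose_mat (P * E) *\<^sub>v a) \<bullet> e
      - (transpose_mat E *\<^sub>v (P *\<^sub>v c)) \<bullet> b + b \<bullet> ((transpose_mat E * P * E) *\<^sub>v e)" .
  have t: "transpose_mat (P * E) *\<^sub>v a \<in> carrier_vec s" "transpose_mat E *\<^sub>v (P *\<^sub>v c) \<in> carrier_vec s"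
    using mult_mat_vec_carrier[of "transpose_mat (P * E)" s n a] mult_carrier_mat[OF Pc E] E abce(1) Pc'(1) by auto
  have EPE: "transpose_mat E * P * E \<in> carrier_mat s s"
    using mult_carrier_mat[OF mult_carrier_mat[OF _ Pc] E] E by simp
  let ?k = "induced_norm2 (transpose_mat E * P * E)"
  \<comment> \<open>The unknown \<open>D0\<close> enters only through the norms of \<open>b\<close>
    and \<open>e\<close>, each of which costs one factor \<open>nd\<close>.\<close>
  have "- ((transpose_mat (P * E) *\<^sub>v a) \<bullet> e) \<le> euclid_norm (transpose_mat (P * E) *\<^sub>v a) * euclid_norm e"
    using scalar_prod_le_euclid_norm[OF t(1) abce(4)] by simp
  also have "\<dots> \<le> euclid_norm (transpose_mat (P * E) *\<^sub>v a) * (nd * euclid_norm g2)"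
    by (intro mult_left_mono nb) simp
  finally have 3: "- ((transpose_mat (P * E) *\<^sub>v a) \<bullet> e)
      \<le> nd * euclid_norm (transpose_mat (P * E) *\<^sub>v a) * euclid_norm g2"
    by (simp add: algebra_simps)
  have "- ((transpose_mat E *\<^sub>v (P *\<^sub>v c)) \<bullet> b) \<le> euclid_norm (transpose_mat E *\<^sub>v (P *\<^sub>v c)) * euclid_norm b"
    using scalar_prod_le_euclid_norm[OF t(2) abce(3)] by simp
  also have "\<dots> \<le> euclid_norm (transpose_mat E *\<^sub>v (P *\<^sub>v c)) * (nd * euclid_norm h)"
    by (intro mult_left_mono nb) simp
  finally have 4: "- ((transpose_mat E *\<^sub>v (P *\<^sub>v c)) \<bullet> b)
      \<le> nd * euclid_norm h * euclid_norm (transpose_mat E *\<^sub>v (P *\<^sub>v c))"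
    by (simp add: algebra_simps)
  have "b \<bullet> ((transpose_mat E * P * E) *\<^sub>v e) \<le> euclid_norm b * euclid_norm ((transpose_mat E * P * E) *\<^sub>v e)"
    using scalar_prod_le_euclid_norm[OF abce(3) mult_mat_vec_carrier[OF EPE abce(4)]] by simp
  also have "\<dots> \<le> (nd * euclid_norm h) * (?k * (nd * euclid_norm g2))"
    by (intro mult_mono nb order_trans[OF euclid_norm_mult_mat_vec_le[OF EPE abce(4)]] mult_left_mono
        mult_nonneg_nonneg) (simp_all add: induced_norm2_nonneg nd)
  finally have 5: "b \<bullet> ((transpose_mat E * P * E) *\<^sub>v e) \<le> nd\<^sup>2 * ?k * euclid_norm h * euclid_norm g2"
    by (simp add: algebra_simps power2_eq_square)
  show ?thesis using 1 2 3 4 5 by (simp add: a_def c_def y_def)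
qed

text \<open>Pulling \<open>X1\<close> out of the sum produces \<open>X1 h\<close>, the shape in
  which \<open>quadratic_form_perturbation\<close> delivers its bound.\<close>

lemma ell_eq:
  assumes X1: "X1 \<in> carrier_mat n T" and G1: "G1 \<in> carrier_mat T n" and G2: "G2 \<in> carrier_mat T r"
    and v: "v \<in> carrier_vec n" and q: "Q v \<in> carrier_vec r"
  defines "h \<equiv> 2 \<cdot>\<^sub>v (G1 *\<^sub>v v) + G2 *\<^sub>v Q v" and "g2 \<equiv> G2 *\<^sub>v Q v"
  shows "ell \<Omega> \<Delta> E X1 P1 G1 G2 Q v = - (v \<bullet> ((minv P1 * \<Omega> * minv P1) *\<^sub>v v))
    + (X1 *\<^sub>v h) \<bullet> (minv P1 *\<^sub>v (X1 *\<^sub>v g2))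
    + induced_norm2 \<Delta> * euclid_norm (transpose_mat (minv P1 * E) *\<^sub>v (X1 *\<^sub>v h)) * euclid_norm g2
    + induced_norm2 \<Delta> * euclid_norm h * euclid_norm (transpose_mat E *\<^sub>v (minv P1 *\<^sub>v (X1 *\<^sub>v g2)))
    + (induced_norm2 \<Delta>)\<^sup>2 * induced_norm2 (transpose_mat E * minv P1 * E) * euclid_norm h * euclid_norm g2"
proof -
  have g1: "G1 *\<^sub>v v \<in> carrier_vec T" and g2: "G2 *\<^sub>v Q v \<in> carrier_vec T"
    using mult_mat_vec_carrier[OF G1 v] mult_mat_vec_carrier[OF G2 q] .
  have "X1 *\<^sub>v h = 2 \<cdot>\<^sub>v (X1 *\<^sub>v (G1 *\<^sub>v v)) + X1 *\<^sub>v (G2 *\<^sub>v Q v)"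
    unfolding h_def using mult_add_distrib_mat_vec[OF X1 _ g2, of "2 \<cdot>\<^sub>v (G1 *\<^sub>v v)"]
      mult_mat_vec[OF X1 g1] g1 by simp
  then show ?thesis
    by (simp add: ell_def ell1_def ell2_def ell3_def ell4_def h_def g2_def)
qed

text \<open>In terms of \<open>w = P1\<^sup>-\<^sup>1 v\<close>, the perturbation terms amount to
  \<open>ell\<close> plus \<open>w \<bullet> \<Omega> w\<close>, and the LMI supplies exactly
  \<open>- w \<bullet> \<Omega> w\<close>, so the two cancel. The margin \<open>\<delta>\<close>
  that remains becomes the contraction factor.\<close>

lemma lyap_closed_loop_decrease:
  assumes P1: "pos_def n P1" and \<Omega>: "\<Omega> \<in> carrier_mat n n"
    and c: "\<Delta> \<in> carrier_mat s p" "E \<in> carrier_mat n s" "X1 \<in> carrier_mat n T" "Y1 \<in> carrier_mat T n"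
    and D0: "D0 \<in> carrier_mat s T" and G2: "G2 \<in> carrier_mat T r"
    and noise: "loewner_le s (D0 * transpose_mat D0) (\<Delta> * transpose_mat \<Delta>)"
    and eps: "0 < \<epsilon>"
    and lmi: "pos_def (n + n + T) (lmi_mat n T \<Omega> \<Delta> E X1 P1 Y1 \<epsilon>)"
    and G1: "G1 = Y1 * minv P1"
  shows "\<exists>q\<ge>0. q < 1 \<and> (\<forall>v\<in>carrier_vec n. Q v \<in> carrier_vec r \<longrightarrow>
    lyap P1 ((X1 - E * D0) *\<^sub>v (G1 *\<^sub>v v + G2 *\<^sub>v Q v)) \<le> q * lyap P1 v + ell \<Omega> \<Delta> E X1 P1 G1 G2 Q v)"
proof -
  note inv = pos_def_inverse[OF P1]
  have P1c: "P1 \<in> carrier_mat n n" using P1 by (simp add: pos_def_def sym_mat_def)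
  have s: "sym_mat n (minv P1)" using pos_def_minv[OF P1] by (simp add: pos_def_def)
  have G1c: "G1 \<in> carrier_mat T n" unfolding G1 by (rule mult_carrier_mat[OF c(4) inv(1)])
  define nd where "nd = induced_norm2 \<Delta>"
  have nd: "0 \<le> nd" by (simp add: nd_def induced_norm2_nonneg)
  \<comment> \<open>The noise bound concerns transposes: the norm of \<open>\<Delta>\<close> is
    passed to \<open>transpose_mat \<Delta>\<close>, then to \<open>transpose_mat D0\<close>, and by
    a second transposition to \<open>D0\<close>.\<close>
  have "euclid_norm (transpose_mat D0 *\<^sub>v w) \<le> nd * euclid_norm w" if w: "w \<in> carrier_vec s" for w
    unfolding nd_def
    by (rule order_trans[OF loewner_le_gram[OF D0 c(1) noise w]
        euclid_norm_transpose_le[OF c(1) w euclid_norm_mult_mat_vec_le[OF c(1)] induced_norm2_nonneg]])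
  then have D0_bound: "euclid_norm (D0 *\<^sub>v v) \<le> nd * euclid_norm v" if "v \<in> carrier_vec T" for v
    using euclid_norm_transpose_le[of "transpose_mat D0" T s v nd] D0 that nd by simp
  obtain \<delta> where \<delta>: "0 < \<delta>" "\<And>w. w \<in> carrier_vec n \<Longrightarrow>
      lyap P1 ((X1 - E * D0) *\<^sub>v (Y1 *\<^sub>v w)) \<le> w \<bullet> (P1 *\<^sub>v w) - w \<bullet> (\<Omega> *\<^sub>v w) - \<delta> * (w \<bullet> w)"
    using lmi_mat_imp_decrease[OF P1 \<Omega> c D0 noise eps lmi] by blast
  obtain C where C: "0 < C" "\<And>w. w \<in> carrier_vec n \<Longrightarrow> w \<bullet> (P1 *\<^sub>v w) \<le> C * (w \<bullet> w)"
    using quadratic_form_bounded[OF P1c] by blast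
  \<comment> \<open>Since \<open>lyap P1 v = w \<bullet> P1 w \<le> C (w \<bullet> w)\<close>, the
    margin removes at least the fraction \<open>\<delta> / C\<close> of \<open>lyap P1 v\<close>.
    The maximum with 0 is taken because nothing in the choice of \<open>\<delta>\<close> and
    \<open>C\<close> rules out \<open>\<delta> > C\<close>.\<close>
  define q where "q = max 0 (1 - \<delta> / C)"
  have q: "0 \<le> q" "q < 1" using \<delta>(1) C(1) by (simp_all add: q_def)
  moreover have "lyap P1 ((X1 - E * D0) *\<^sub>v (G1 *\<^sub>v v + G2 *\<^sub>v Q v)) \<le> q * lyap P1 v + ell \<Omega> \<Delta> E X1 P1 G1 G2 Q v"
    if v: "v \<in> carrier_vec n" and Qv: "Q v \<in> carrier_vec r" for v
  proof -
    define w where "w = minv P1 *\<^sub>v v"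
    have w: "w \<in> carrier_vec n" unfolding w_def by (rule mult_mat_vec_carrier[OF inv(1) v])
    have \<Omega>w: "\<Omega> *\<^sub>v w \<in> carrier_vec n" by (rule mult_mat_vec_carrier[OF \<Omega> w])
    have P1w: "P1 *\<^sub>v w = v" using assoc_mult_mat_vec[OF P1c inv(1) v] inv(2) v by (simp add: w_def)
    have G1v: "G1 *\<^sub>v v = Y1 *\<^sub>v w" unfolding G1 w_def by (rule assoc_mult_mat_vec[OF c(4) inv(1) v])
    have lw: "lyap P1 v = w \<bullet> (P1 *\<^sub>v w)"
      using comm_scalar_prod[OF v w] by (simp add: lyap_def P1w w_def[symmetric])
    have \<Omega>v: "v \<bullet> ((minv P1 * \<Omega> * minv P1) *\<^sub>v v) = w \<bullet> (\<Omega> *\<^sub>v w)"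
      using assoc_mult_mat_vec[OF mult_carrier_mat[OF inv(1) \<Omega>] inv(1) v] assoc_mult_mat_vec[OF inv(1) \<Omega> w]
        sym_mat_scalar_prod[OF s v \<Omega>w] comm_scalar_prod[OF w \<Omega>w] by (simp add: w_def)
    have g: "G1 *\<^sub>v v \<in> carrier_vec T" "G2 *\<^sub>v Q v \<in> carrier_vec T"
      by (rule mult_mat_vec_carrier[OF G1c v], rule mult_mat_vec_carrier[OF G2 Qv])
    have "lyap P1 ((X1 - E * D0) *\<^sub>v (G1 *\<^sub>v v + G2 *\<^sub>v Q v))
      \<le> lyap P1 ((X1 - E * D0) *\<^sub>v (Y1 *\<^sub>v w)) + w \<bullet> (\<Omega> *\<^sub>v w) + ell \<Omega> \<Delta> E X1 P1 G1 G2 Q v"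
      using quadratic_form_perturbation[OF s c(3,2) D0 g nd D0_bound]
      unfolding ell_eq[where Q = Q and v = v, OF c(3) G1c G2 v Qv] lyap_def \<Omega>v nd_def G1v by simp
    also have "\<dots> \<le> lyap P1 v - \<delta> * (w \<bullet> w) + ell \<Omega> \<Delta> E X1 P1 G1 G2 Q v"
      using \<delta>(2)[OF w] by (simp add: lw)
    also have "\<dots> \<le> q * lyap P1 v + ell \<Omega> \<Delta> E X1 P1 G1 G2 Q v"
    proof -
      have "lyap P1 v / C \<le> w \<bullet> w" using C(2)[OF w] C(1) by (simp add: lw field_simps)
      then have "\<delta> * (lyap P1 v / C) \<le> \<delta> * (w \<bullet> w)" using \<delta>(1) by (intro mult_left_mono) auto
      then have "lyap P1 v - \<delta> * (w \<bullet> w) \<le> (1 - \<delta> / C) * lyap P1 v" by (simp add: algebra_simps)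
      also have "\<dots> \<le> q * lyap P1 v"
        using pos_def_imp_pos_semidef[OF pos_def_minv[OF P1]] v
        by (intro mult_right_mono) (simp_all add: q_def lyap_def pos_semidef_def)
      finally show ?thesis by simp
    qed
    finally show ?thesis .
  qed
  ultimately show ?thesis by blast
qed

section \<open>Sign of \<open>ell\<close> near the origin\<close>

text \<open>Each of \<open>ell1\<close> through \<open>ell4\<close> is bounded by a multiple of
  \<open>|h| |G2 Q(v)|\<close>. The second factor is of order \<open>\<eta> |v|\<close>, and the
  first is of order \<open>|v|\<close> because \<open>\<eta> \<le> 1\<close>.\<close>

lemma ell_near_zero_bound:
  assumes P: "minv P1 \<in> carrier_mat n n" and X1: "X1 \<in> carrier_mat n T" and E: "E \<in> carrier_mat n s"
    and G1: "G1 \<in> carrier_mat T n" and G2: "G2 \<in> carrier_mat T r"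
    and Q: "Q \<in> carrier_vec n \<rightarrow> carrier_vec r"
  shows "\<exists>C>0. \<forall>v\<in>carrier_vec n. \<forall>\<eta>. 0 \<le> \<eta> \<longrightarrow> \<eta> \<le> 1 \<longrightarrow> euclid_norm (Q v) \<le> \<eta> * euclid_norm v \<longrightarrow>
    ell \<Omega> \<Delta> E X1 P1 G1 G2 Q v
      \<le> - (v \<bullet> ((minv P1 * \<Omega> * minv P1) *\<^sub>v v)) + C * \<eta> * (euclid_norm v)\<^sup>2"
proof -
  have PE: "transpose_mat (minv P1 * E) \<in> carrier_mat s n" and ET: "transpose_mat E \<in> carrier_mat s n"
    using mult_carrier_mat[OF P E] E by simp_all
  obtain cp where cp: "0 < cp" "\<And>v. v \<in> carrier_vec n \<Longrightarrow> euclid_norm (minv P1 *\<^sub>v v) \<le> cp * euclid_norm v"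
    using mult_mat_vec_bounded[OF P] by blast
  obtain cx where cx: "0 < cx" "\<And>v. v \<in> carrier_vec T \<Longrightarrow> euclid_norm (X1 *\<^sub>v v) \<le> cx * euclid_norm v"
    using mult_mat_vec_bounded[OF X1] by blast
  obtain ct where ct: "0 < ct"
    "\<And>v. v \<in> carrier_vec n \<Longrightarrow> euclid_norm (transpose_mat (minv P1 * E) *\<^sub>v v) \<le> ct * euclid_norm v"
    using mult_mat_vec_bounded[OF PE] by blast
  obtain ce where ce: "0 < ce"
    "\<And>v. v \<in> carrier_vec n \<Longrightarrow> euclid_norm (transpose_mat E *\<^sub>v v) \<le> ce * euclid_norm v"
    using mult_mat_vec_bounded[OF ET] by blast
  obtain c1 where c1: "0 < c1" "\<And>v. v \<in> carrier_vec n \<Longrightarrow> euclid_norm (G1 *\<^sub>v v) \<le> c1 * euclid_norm v"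
    using mult_mat_vec_bounded[OF G1] by blast
  obtain c2 where c2: "0 < c2" "\<And>v. v \<in> carrier_vec r \<Longrightarrow> euclid_norm (G2 *\<^sub>v v) \<le> c2 * euclid_norm v"
    using mult_mat_vec_bounded[OF G2] by blast
  define nd where "nd = induced_norm2 \<Delta>"
  define ne where "ne = induced_norm2 (transpose_mat E * minv P1 * E)"
  have nd: "0 \<le> nd" "0 \<le> ne" by (simp_all add: nd_def ne_def induced_norm2_nonneg)
  \<comment> \<open>This comes from \<open>|h| \<le> 2 |g1| + |g2|\<close>, with
    \<open>\<eta> \<le> 1\<close> absorbed in the second summand.\<close>
  define ch where "ch = 2 * c1 + c2"
  have ch: "0 < ch" using c1 c2 by (simp add: ch_def)
  \<comment> \<open>One summand for each of \<open>ell1\<close> through \<open>ell4\<close>, with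
    the factors \<open>t\<close> and \<open>\<eta> * t\<close> taken out.\<close>
  define C where "C = cx * ch * (cp * (cx * c2)) + nd * (ct * (cx * ch)) * c2
    + nd * ch * (ce * (cp * (cx * c2))) + nd\<^sup>2 * ne * ch * c2"
  have "0 < C" unfolding C_def
    using cp(1) cx(1) ct(1) ce(1) ch c2(1) nd by (intro add_pos_nonneg mult_pos_pos mult_nonneg_nonneg) simp_all
  moreover have "ell \<Omega> \<Delta> E X1 P1 G1 G2 Q v
      \<le> - (v \<bullet> ((minv P1 * \<Omega> * minv P1) *\<^sub>v v)) + C * \<eta> * (euclid_norm v)\<^sup>2"
    if v: "v \<in> carrier_vec n" and \<eta>: "0 \<le> \<eta>" "\<eta> \<le> 1" "euclid_norm (Q v) \<le> \<eta> * euclid_norm v" for v \<eta>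
  proof -
    have Qv: "Q v \<in> carrier_vec r" using Q v by auto
    define t where "t = euclid_norm v"
    define g1 where "g1 = G1 *\<^sub>v v"
    define g2 where "g2 = G2 *\<^sub>v Q v"
    define h where "h = 2 \<cdot>\<^sub>v g1 + g2"
    define a where "a = X1 *\<^sub>v h"
    define b where "b = X1 *\<^sub>v g2"
    have t: "0 \<le> t" by (simp add: t_def)
    have g: "g1 \<in> carrier_vec T" "g2 \<in> carrier_vec T"
      unfolding g1_def g2_def by (rule mult_mat_vec_carrier[OF G1 v], rule mult_mat_vec_carrier[OF G2 Qv])
    have h: "h \<in> carrier_vec T" using g by (simp add: h_def)
    have ab: "a \<in> carrier_vec n" "b \<in> carrier_vec n"
      unfolding a_def b_def by (rule mult_mat_vec_carrier[OF X1 h], rule mult_mat_vec_carrier[OF X1 g(2)])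
    have Pb: "minv P1 *\<^sub>v b \<in> carrier_vec n" by (rule mult_mat_vec_carrier[OF P ab(2)])
    have ng1: "euclid_norm g1 \<le> c1 * t" using c1(2)[OF v] by (simp add: g1_def t_def)
    have "euclid_norm g2 \<le> c2 * euclid_norm (Q v)" using c2(2)[OF Qv] by (simp add: g2_def)
    also have "\<dots> \<le> c2 * (\<eta> * t)" using \<eta>(3) c2(1) by (intro mult_left_mono) (simp_all add: t_def)
    finally have ng2: "euclid_norm g2 \<le> c2 * (\<eta> * t)" .
    have "\<eta> * t \<le> t" using \<eta> t by (simp add: mult_left_le_one_le)
    then have "c2 * (\<eta> * t) \<le> c2 * t" using c2(1) by simp
    then have nh: "euclid_norm h \<le> ch * t"
      using euclid_norm_add_le[of "2 \<cdot>\<^sub>v g1" T g2] g ng1 ng2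
      by (simp add: h_def ch_def euclid_norm_smult algebra_simps)
    have na: "euclid_norm a \<le> cx * (ch * t)"
      unfolding a_def by (rule order_trans[OF cx(2)[OF h]], intro mult_left_mono nh) (use cx in simp)
    have nb: "euclid_norm b \<le> cx * (c2 * (\<eta> * t))"
      unfolding b_def by (rule order_trans[OF cx(2)[OF g(2)]], intro mult_left_mono ng2) (use cx in simp)
    have nPb: "euclid_norm (minv P1 *\<^sub>v b) \<le> cp * (cx * (c2 * (\<eta> * t)))"
      by (rule order_trans[OF cp(2)[OF ab(2)]], intro mult_left_mono nb) (use cp in simp)
    have nEPb: "euclid_norm (transpose_mat E *\<^sub>v (minv P1 *\<^sub>v b)) \<le> ce * (cp * (cx * (c2 * (\<eta> * t))))"
      by (rule order_trans[OF ce(2)[OF Pb]], intro mult_left_mono nPb) (use ce in simp)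
    have nPEa: "euclid_norm (transpose_mat (minv P1 * E) *\<^sub>v a) \<le> ct * (cx * (ch * t))"
      by (rule order_trans[OF ct(2)[OF ab(1)]], intro mult_left_mono na) (use ct in simp)
    note pos = cp(1) cx(1) ct(1) ce(1) ch c2(1) nd t \<eta>(1)
    have "a \<bullet> (minv P1 *\<^sub>v b) \<le> euclid_norm a * euclid_norm (minv P1 *\<^sub>v b)"
      using scalar_prod_le_euclid_norm[OF ab(1) Pb] by simp
    also have "\<dots> \<le> (cx * (ch * t)) * (cp * (cx * (c2 * (\<eta> * t))))"
      by (intro mult_mono na nPb mult_nonneg_nonneg) (use pos in simp_all)
    finally have 1: "a \<bullet> (minv P1 *\<^sub>v b) \<le> (cx * (ch * t)) * (cp * (cx * (c2 * (\<eta> * t))))" .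
    have 2: "nd * euclid_norm (transpose_mat (minv P1 * E) *\<^sub>v a) * euclid_norm g2
        \<le> nd * (ct * (cx * (ch * t))) * (c2 * (\<eta> * t))"
      by (intro mult_mono nPEa ng2 mult_nonneg_nonneg order_refl) (use pos in simp_all)
    have 3: "nd * euclid_norm h * euclid_norm (transpose_mat E *\<^sub>v (minv P1 *\<^sub>v b))
        \<le> nd * (ch * t) * (ce * (cp * (cx * (c2 * (\<eta> * t)))))"
      by (intro mult_mono nEPb nh mult_nonneg_nonneg order_refl) (use pos in simp_all)
    have 4: "nd\<^sup>2 * ne * euclid_norm h * euclid_norm g2 \<le> nd\<^sup>2 * ne * (ch * t) * (c2 * (\<eta> * t))"
      by (intro mult_mono nh ng2 mult_nonneg_nonneg order_refl) (use pos in simp_all)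
    have "C * \<eta> * t\<^sup>2 = (cx * (ch * t)) * (cp * (cx * (c2 * (\<eta> * t))))
      + nd * (ct * (cx * (ch * t))) * (c2 * (\<eta> * t))
      + nd * (ch * t) * (ce * (cp * (cx * (c2 * (\<eta> * t)))))
      + nd\<^sup>2 * ne * (ch * t) * (c2 * (\<eta> * t))"
      by (simp add: C_def algebra_simps power2_eq_square)
    with 1 2 3 4 show ?thesis
      unfolding ell_eq[where Q = Q and v = v, OF X1 G1 G2 v Qv] nd_def[symmetric] ne_def[symmetric] g1_def[symmetric]
        g2_def[symmetric] h_def[symmetric] a_def[symmetric] b_def[symmetric] t_def[symmetric]
      by linarith
  qed
  ultimately show ?thesis by blast
qed

text \<open>The filter lets \<open>|v|\<close> tend to 0 from the right within the carrier, so it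
  says nothing at the origin, and the conclusion excludes that point.\<close>

lemma littleo_at_zeroD:
  assumes lim: "((\<lambda>v. euclid_norm (Q v) / euclid_norm v) \<longlongrightarrow> 0)
      (inf (filtercomap euclid_norm (at_right 0)) (principal (carrier_vec n)))"
    and \<eta>: "0 < \<eta>"
  shows "\<exists>r>0. \<forall>v\<in>carrier_vec n. v \<noteq> 0\<^sub>v n \<longrightarrow> euclid_norm v < r \<longrightarrow> euclid_norm (Q v) \<le> \<eta> * euclid_norm v"
proof -
  have "eventually (\<lambda>v. euclid_norm (Q v) / euclid_norm v < \<eta>)
      (inf (filtercomap euclid_norm (at_right 0)) (principal (carrier_vec n)))"
    using order_tendstoD(2)[OF lim \<eta>] .
  then obtain S where S: "eventually S (at_right (0 :: real))"
    "\<And>v. S (euclid_norm v) \<Longrightarrow> v \<in> carrier_vec n \<Longrightarrow> euclid_norm (Q v) / euclid_norm v < \<eta>"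
    unfolding eventually_inf_principal eventually_filtercomap by blast
  then obtain r where r: "0 < r" "\<And>y. 0 < y \<Longrightarrow> y < r \<Longrightarrow> S y"
    unfolding eventually_at_right_field by auto
  have "euclid_norm (Q v) \<le> \<eta> * euclid_norm v"
    if v: "v \<in> carrier_vec n" "v \<noteq> 0\<^sub>v n" "euclid_norm v < r" for v
  proof -
    have "0 < euclid_norm v" using euclid_norm_eq_0[OF v(1)] v(2) by (simp add: less_le)
    then show ?thesis using S(2)[OF r(2) v(1)] v(3) by (simp add: field_simps)
  qed
  then show ?thesis using r(1) by blast
qed

text \<open>As \<open>v = P1 w\<close>, the length of \<open>v\<close> is at most a multiple of that
  of \<open>w\<close>, so coercivity of \<open>\<Omega>\<close> in \<open>w\<close> transfers to
  \<open>v\<close>.\<close>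

lemma congruence_coercive:
  assumes P1: "pos_def n P1" and \<Omega>: "pos_def n \<Omega>"
  shows "\<exists>c>0. \<forall>v\<in>carrier_vec n. c * (euclid_norm v)\<^sup>2 \<le> v \<bullet> ((minv P1 * \<Omega> * minv P1) *\<^sub>v v)"
proof -
  note inv = pos_def_inverse[OF P1]
  have c: "P1 \<in> carrier_mat n n" "\<Omega> \<in> carrier_mat n n" using P1 \<Omega> by (simp_all add: pos_def_def sym_mat_def)
  have s: "sym_mat n (minv P1)" using pos_def_minv[OF P1] by (simp add: pos_def_def)
  obtain b where b: "0 < b" "\<And>w. w \<in> carrier_vec n \<Longrightarrow> b * (w \<bullet> w) \<le> w \<bullet> (\<Omega> *\<^sub>v w)"
    using pos_def_coercive[OF \<Omega>] by blast
  obtain C where C: "0 < C" "\<And>w. w \<in> carrier_vec n \<Longrightarrow> euclid_norm (P1 *\<^sub>v w) \<le> C * euclid_norm w"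
    using mult_mat_vec_bounded[OF c(1)] by blast
  have "b / C\<^sup>2 * (euclid_norm v)\<^sup>2 \<le> v \<bullet> ((minv P1 * \<Omega> * minv P1) *\<^sub>v v)" if v: "v \<in> carrier_vec n" for v
  proof -
    define w where "w = minv P1 *\<^sub>v v"
    have w: "w \<in> carrier_vec n" unfolding w_def by (rule mult_mat_vec_carrier[OF inv(1) v])
    have \<Omega>w: "\<Omega> *\<^sub>v w \<in> carrier_vec n" by (rule mult_mat_vec_carrier[OF c(2) w])
    have "P1 *\<^sub>v w = v" using assoc_mult_mat_vec[OF c(1) inv(1) v] inv(2) v by (simp add: w_def)
    then have "(euclid_norm v)\<^sup>2 \<le> (C * euclid_norm w)\<^sup>2"
      using C(2)[OF w] by (intro power_mono) auto
    then have "b * (euclid_norm v)\<^sup>2 \<le> C\<^sup>2 * (b * (w \<bullet> w))"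
      using b(1) by (simp add: power_mult_distrib euclid_norm_power2[of w])
    also have "\<dots> \<le> C\<^sup>2 * (w \<bullet> (\<Omega> *\<^sub>v w))" using b(2)[OF w] by (intro mult_left_mono) auto
    also have "w \<bullet> (\<Omega> *\<^sub>v w) = v \<bullet> ((minv P1 * \<Omega> * minv P1) *\<^sub>v v)"
      using assoc_mult_mat_vec[OF mult_carrier_mat[OF inv(1) c(2)] inv(1) v] assoc_mult_mat_vec[OF inv(1) c(2) w]
        sym_mat_scalar_prod[OF s v \<Omega>w] comm_scalar_prod[OF w \<Omega>w] by (simp add: w_def)
    finally show ?thesis using C(1) by (simp add: field_simps)
  qed
  moreover have "0 < b / C\<^sup>2" using b(1) C(1) by simp
  ultimately show ?thesis by blast
qed

text \<open>The first term of \<open>ell\<close> is at most a negative multiple of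
  \<open>|v|^2\<close>, while the others are of order \<open>\<eta> |v|^2\<close> with
  \<open>\<eta>\<close> as small as desired close to 0.\<close>

lemma ell_negative_near_zero:
  assumes P1: "pos_def n P1" and \<Omega>: "pos_def n \<Omega>" and X1: "X1 \<in> carrier_mat n T" and E: "E \<in> carrier_mat n s"
    and G1: "G1 \<in> carrier_mat T n" and G2: "G2 \<in> carrier_mat T r"
    and Q: "Q \<in> carrier_vec n \<rightarrow> carrier_vec r"
    and lim: "((\<lambda>v. euclid_norm (Q v) / euclid_norm v) \<longlongrightarrow> 0)
      (inf (filtercomap euclid_norm (at_right 0)) (principal (carrier_vec n)))"
  shows "\<exists>r>0. \<forall>v\<in>carrier_vec n. v \<noteq> 0\<^sub>v n \<longrightarrow> euclid_norm v < r \<longrightarrow> ell \<Omega> \<Delta> E X1 P1 G1 G2 Q v < 0"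
proof -
  obtain C where C: "0 < C" "\<And>v \<eta>. v \<in> carrier_vec n \<Longrightarrow> 0 \<le> \<eta> \<Longrightarrow> \<eta> \<le> 1 \<Longrightarrow>
      euclid_norm (Q v) \<le> \<eta> * euclid_norm v \<Longrightarrow> ell \<Omega> \<Delta> E X1 P1 G1 G2 Q v
        \<le> - (v \<bullet> ((minv P1 * \<Omega> * minv P1) *\<^sub>v v)) + C * \<eta> * (euclid_norm v)\<^sup>2"
    using ell_near_zero_bound[OF pos_def_inverse(1)[OF P1] X1 E G1 G2 Q] by blast
  obtain c where c: "0 < c"
    "\<And>v. v \<in> carrier_vec n \<Longrightarrow> c * (euclid_norm v)\<^sup>2 \<le> v \<bullet> ((minv P1 * \<Omega> * minv P1) *\<^sub>v v)"
    using congruence_coercive[OF P1 \<Omega>] by blast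
  \<comment> \<open>The value \<open>c / (2 * C)\<close> makes the remainder at most half of the
    coercive term; \<open>1\<close> respects the range of \<open>\<eta>\<close> in
    \<open>ell_near_zero_bound\<close>.\<close>
  define \<eta> where "\<eta> = min 1 (c / (2 * C))"
  have \<eta>: "0 < \<eta>" "\<eta> \<le> 1" using c(1) C(1) by (simp_all add: \<eta>_def)
  have "C * \<eta> \<le> C * (c / (2 * C))" using C(1) by (intro mult_left_mono) (simp_all add: \<eta>_def)
  then have C\<eta>: "C * \<eta> \<le> c / 2" using C(1) by simp
  obtain r where r: "0 < r" "\<And>v. v \<in> carrier_vec n \<Longrightarrow> v \<noteq> 0\<^sub>v n \<Longrightarrow> euclid_norm v < r \<Longrightarrow>
      euclid_norm (Q v) \<le> \<eta> * euclid_norm v"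
    using littleo_at_zeroD[OF lim \<eta>(1)] by blast
  have "ell \<Omega> \<Delta> E X1 P1 G1 G2 Q v < 0" if v: "v \<in> carrier_vec n" "v \<noteq> 0\<^sub>v n" "euclid_norm v < r" for v
  proof -
    have v0: "0 < (euclid_norm v)\<^sup>2" using euclid_norm_eq_0[OF v(1)] v(2) by simp
    have "C * \<eta> * (euclid_norm v)\<^sup>2 \<le> c / 2 * (euclid_norm v)\<^sup>2" by (intro mult_right_mono C\<eta>) simp
    also have "\<dots> < c * (euclid_norm v)\<^sup>2" using c(1) v0 by simp
    finally show ?thesis using C(2)[OF v(1) _ \<eta>(2) r(2)[OF v]] \<eta>(1) c(2)[OF v(1)] by simp
  qed
  then show ?thesis using r(1) by blast
qed

subsection \<open>Geometric decay of a Lyapunov function\<close>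

text \<open>The decrease is available only up to level \<open>\<gamma>\<close>. Since
  \<open>V\<close> never rises, carrying \<open>V \<le> V v\<close> through the induction keeps the
  orbit where the decrease applies.\<close>

lemma funpow_sublevel:
  assumes f: "f \<in> carrier_vec n \<rightarrow> carrier_vec n" and V: "\<And>v. v \<in> carrier_vec n \<Longrightarrow> 0 \<le> V v"
    and q: "0 \<le> q" "q < (1 :: real)"
    and decr: "\<And>v. v \<in> carrier_vec n \<Longrightarrow> V v \<le> \<gamma> \<Longrightarrow> V (f v) \<le> q * V v"
    and v: "v \<in> carrier_vec n" "V v \<le> \<gamma>"
  shows "(f ^^ t) v \<in> carrier_vec n \<and> V ((f ^^ t) v) \<le> q ^ t * V v \<and> V ((f ^^ t) v) \<le> V v"
proof (induction t)
  case 0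
  then show ?case using v by simp
next
  case (Suc t)
  let ?x = "(f ^^ t) v"
  have x: "?x \<in> carrier_vec n" "V ?x \<le> q ^ t * V v" "V ?x \<le> V v" using Suc by auto
  have "V (f ?x) \<le> q * V ?x" using decr x v(2) by simp
  moreover have "q * V ?x \<le> q ^ Suc t * V v"
    using mult_left_mono[OF x(2) q(1)] by (simp add: algebra_simps)
  moreover have "q * V ?x \<le> V ?x"
    using q V[OF x(1)] by (simp add: mult_left_le_one_le)
  ultimately show ?case using f x by auto
qed

text \<open>The squared norm is squeezed between 0 and a geometric sequence, and the square root is
  continuous.\<close>

lemma solution_tendsto_of_geometric:
  assumes c: "0 < c" "\<And>v. v \<in> carrier_vec n \<Longrightarrow> c * (euclid_norm v)\<^sup>2 \<le> V v"
    and q: "0 \<le> q" "q < (1 :: real)"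
    and sol: "\<And>t. (f ^^ t) v \<in> carrier_vec n" "\<And>t. V ((f ^^ t) v) \<le> q ^ t * V v"
  shows "solution_tendsto f v (0\<^sub>v n)"
proof -
  have "(\<lambda>t. (euclid_norm ((f ^^ t) v))\<^sup>2) \<longlonglongrightarrow> 0"
  proof (rule real_tendsto_sandwich[where f = "\<lambda>_. 0" and h = "\<lambda>t. q ^ t * (V v / c)"])
    have "(euclid_norm ((f ^^ t) v))\<^sup>2 \<le> q ^ t * (V v / c)" for t
      using order_trans[OF c(2)[OF sol(1)[of t]] sol(2)[of t]] c(1) by (simp add: field_simps)
    then show "\<forall>\<^sub>F t in sequentially. (euclid_norm ((f ^^ t) v))\<^sup>2 \<le> q ^ t * (V v / c)" by simp
    show "(\<lambda>t. q ^ t * (V v / c)) \<longlonglongrightarrow> 0"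
      using q by (intro tendsto_mult_left_zero LIMSEQ_realpow_zero) auto
  qed simp_all
  from tendsto_real_sqrt[OF this] have "(\<lambda>t. euclid_norm ((f ^^ t) v)) \<longlonglongrightarrow> 0"
    by simp
  moreover have "(f ^^ t) v - 0\<^sub>v n = (f ^^ t) v" for t
    using sol(1)[of t] by (intro eq_vecI) auto
  ultimately show ?thesis by (simp add: solution_tendsto_def)
qed

text \<open>The two quadratic bounds nest balls and sublevel sets of \<open>V\<close> in each other:
  a start in a small ball lies in a sublevel set inside the ball of radius \<open>r\<close>, and
  \<open>funpow_sublevel\<close> traps the orbit there.\<close>

lemma asymptotically_stable_of_lyapunov:
  assumes f: "f \<in> carrier_vec n \<rightarrow> carrier_vec n" and f0: "f (0\<^sub>v n) = 0\<^sub>v n"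
    and c: "0 < c" "\<And>v. v \<in> carrier_vec n \<Longrightarrow> c * (euclid_norm v)\<^sup>2 \<le> V v"
    and C: "0 < C" "\<And>v. v \<in> carrier_vec n \<Longrightarrow> V v \<le> C * (euclid_norm v)\<^sup>2"
    and q: "0 \<le> q" "q < (1 :: real)" and r: "0 < r"
    and decr: "\<And>v. v \<in> carrier_vec n \<Longrightarrow> euclid_norm v < r \<Longrightarrow> V (f v) \<le> q * V v"
  shows "asymptotically_stable n f (0\<^sub>v n)"
proof -
  have V: "0 \<le> V v" if "v \<in> carrier_vec n" for v
    using order_trans[OF _ c(2)[OF that], of 0] c(1) by simp
  have small: "euclid_norm v < e" if "v \<in> carrier_vec n" "0 < e" "V v < c * e\<^sup>2" for v e
  proof -
    have "c * (euclid_norm v)\<^sup>2 < c * e\<^sup>2" using c(2)[OF that(1)] that(3) by simp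
    then have "(euclid_norm v)\<^sup>2 < e\<^sup>2" using c(1) by simp
    then show ?thesis by (rule power2_less_imp_less) (use that(2) in simp)
  qed
  have stays: "\<forall>t. (f ^^ t) v \<in> carrier_vec n \<and> V ((f ^^ t) v) \<le> q ^ t * V v \<and> V ((f ^^ t) v) \<le> V v"
    if v: "v \<in> carrier_vec n" "V v < c * r\<^sup>2" for v
  proof -
    \<comment> \<open>The level is the starting value \<open>V v\<close> itself; every point at or
      below it lies in the ball of radius \<open>r\<close>.\<close>
    have "V (f x) \<le> q * V x" if "x \<in> carrier_vec n" "V x \<le> V v" for x
      using decr[OF that(1) small[OF that(1) r]] that(2) v(2) by simp
    then show ?thesis using funpow_sublevel[where V = V, OF f V q _ v(1) order_refl] by blast
  qed
  \<comment> \<open>The factor \<open>sqrt (c / C)\<close> is what brings the upper bound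
    \<open>C |v|^2\<close> below \<open>c * e\<^sup>2\<close>.\<close>
  have near: "V v < c * e\<^sup>2" if v: "v \<in> carrier_vec n" "0 < e" "euclid_norm v < sqrt (c / C) * e" for v e
  proof -
    have "(euclid_norm v)\<^sup>2 < (sqrt (c / C) * e)\<^sup>2" using v by (intro power_strict_mono) auto
    also have "\<dots> = c / C * e\<^sup>2" using c(1) C(1) by (simp add: power_mult_distrib)
    finally have "C * (euclid_norm v)\<^sup>2 < c * e\<^sup>2" using C(1) by (simp add: field_simps)
    then show ?thesis using C(2)[OF v(1)] by simp
  qed
  have sub0: "v - 0\<^sub>v n = v" if "v \<in> carrier_vec n" for v :: rvec
    using that by (intro eq_vecI) auto
  have pos: "0 < sqrt (c / C) * e" if "0 < e" for e using that c(1) C(1) by simp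
  show ?thesis
    unfolding asymptotically_stable_def
  proof (intro conjI allI impI)
    fix e :: real assume e: "0 < e"
    \<comment> \<open>Here \<open>e\<close> gives the requested accuracy, and \<open>r\<close> keeps
      the start in the region where \<open>V\<close> decreases.\<close>
    let ?e = "min e r"
    have "euclid_norm ((f ^^ t) v - 0\<^sub>v n) < e"
      if v: "v \<in> carrier_vec n" "euclid_norm (v - 0\<^sub>v n) < sqrt (c / C) * ?e" for v t
    proof -
      have Ve: "V v < c * ?e\<^sup>2" using near[of v ?e] v e r by (simp add: sub0)
      also have "\<dots> \<le> c * r\<^sup>2" using c(1) e r by (intro mult_left_mono power_mono) auto
      finally have "(f ^^ t) v \<in> carrier_vec n" "V ((f ^^ t) v) \<le> V v"
        using stays[OF v(1)] by auto
      then show ?thesis using small[of "(f ^^ t) v" ?e] Ve e r by (simp add: sub0)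
    qed
    then show "\<exists>r>0. \<forall>x0\<in>carrier_vec n. euclid_norm (x0 - 0\<^sub>v n) < r \<longrightarrow>
        (\<forall>t. euclid_norm ((f ^^ t) x0 - 0\<^sub>v n) < e)"
      using pos[of ?e] e r by (intro exI[of _ "sqrt (c / C) * ?e"]) auto
  next
    have "solution_tendsto f v (0\<^sub>v n)"
      if v: "v \<in> carrier_vec n" "euclid_norm (v - 0\<^sub>v n) < sqrt (c / C) * r" for v
    proof -
      have "V v < c * r\<^sup>2" using near[of v r] v r by (simp add: sub0)
      from stays[OF v(1) this] show ?thesis
        using solution_tendsto_of_geometric[of c n V q f v] c q by blast
    qed
    then show "\<exists>r>0. \<forall>x0\<in>carrier_vec n. euclid_norm (x0 - 0\<^sub>v n) < r \<longrightarrow> solution_tendsto f x0 (0\<^sub>v n)"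
      using pos[OF r] by (intro exI[of _ "sqrt (c / C) * r"]) auto
  qed (use f0 in simp_all)
qed

subsection \<open>The region of attraction\<close>

theorem proposition2:
  fixes n m s S T p :: nat
    and A B E \<Omega> \<Delta> P1 Y1 G1 G2 K U0 X1 Z0 D0 :: "real mat"
    and Q Z f :: "rvec \<Rightarrow> rvec"
    and x u d :: "nat \<Rightarrow> rvec"
    and \<epsilon> \<gamma> :: real
  assumes dims: "0 < n" "0 < m" "0 < s" "0 < T" "n \<le> S"
    and A: "A \<in> carrier_mat n S"
    and B: "B \<in> carrier_mat n m"
    and E: "E \<in> carrier_mat n s"
    and Q: "Q \<in> carrier_vec n \<rightarrow> carrier_vec (S - n)"
    and Z: "Z = (\<lambda>v. v @\<^sub>v Q v)"
    and x: "\<And>k. k \<le> T \<Longrightarrow> x k \<in> carrier_vec n"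
    and u: "\<And>k. k < T \<Longrightarrow> u k \<in> carrier_vec m"
    and d: "\<And>k. k < T \<Longrightarrow> d k \<in> carrier_vec s"
    and data: "\<And>k. k < T \<Longrightarrow> x (Suc k) = A *\<^sub>v Z (x k) + B *\<^sub>v u k + E *\<^sub>v d k"
    and U0: "U0 = mat_of_cols m (map u [0..<T])"
    and X1: "X1 = mat_of_cols n (map (\<lambda>k. x (Suc k)) [0..<T])"
    and Z0: "Z0 = mat_of_cols S (map (\<lambda>k. Z (x k)) [0..<T])"
    and D0: "D0 = mat_of_cols s (map d [0..<T])"
    and Q_zero: "Q (0\<^sub>v n) = 0\<^sub>v (S - n)"
    and Q_lim: "((\<lambda>v. euclid_norm (Q v) / euclid_norm v) \<longlongrightarrow> 0)
                  (inf (filtercomap euclid_norm (at_right 0)) (principal (carrier_vec n)))"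
    and Omega: "pos_def n \<Omega>"
    and Delta: "\<Delta> \<in> carrier_mat s p"
    and noise: "loewner_le s (D0 * transpose_mat D0) (\<Delta> * transpose_mat \<Delta>)"
    and P1: "sym_mat n P1"
    and Y1: "Y1 \<in> carrier_mat T n"
    and G2: "G2 \<in> carrier_mat T (S - n)"
    and eps: "0 < \<epsilon>"
    and sdp1: "Z0 * Y1 = P1 @\<^sub>r 0\<^sub>m (S - n) n"
    and sdp2: "Z0 * G2 = 0\<^sub>m n (S - n) @\<^sub>r 1\<^sub>m (S - n)"
    and sdp3: "pos_def (n + n + T) (lmi_mat n T \<Omega> \<Delta> E X1 P1 Y1 \<epsilon>)"
    and G1: "G1 = Y1 * minv P1"
    and K: "K = U0 * append_cols G1 G2"
    and f: "f = (\<lambda>v. A *\<^sub>v Z v + B *\<^sub>v (K *\<^sub>v Z v))"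
    and sublevel: "{v \<in> carrier_vec n. lyap P1 v \<le> \<gamma>} \<subseteq>
                   {v \<in> carrier_vec n. ell \<Omega> \<Delta> E X1 P1 G1 G2 Q v < 0} \<union> {0\<^sub>v n}"
  shows "positively_invariant f {v \<in> carrier_vec n. lyap P1 v \<le> \<gamma>} \<and>
         region_of_attraction n f (0\<^sub>v n) {v \<in> carrier_vec n. lyap P1 v \<le> \<gamma>}"
proof -
  \<comment> \<open>\<open>r\<close> may be 0, in which case \<open>Z\<close> has no nonlinear
    block.\<close>
  define r where "r = S - n"
  have S: "S = n + r" using dims by (simp add: r_def)
  have Q': "Q \<in> carrier_vec n \<rightarrow> carrier_vec r" using Q by (simp add: r_def)
  have Zc: "Z v \<in> carrier_vec S" if "v \<in> carrier_vec n" for v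
    using that Q' by (auto simp: Z S)
  have c: "X1 \<in> carrier_mat n T" "Z0 \<in> carrier_mat (n + r) T" "U0 \<in> carrier_mat m T" "D0 \<in> carrier_mat s T"
    by (simp_all add: X1 Z0 U0 D0 S carrier_matI)
  have \<Omega>c: "\<Omega> \<in> carrier_mat n n" using Omega by (simp add: pos_def_def sym_mat_def)
  have A': "A \<in> carrier_mat n (n + r)" and G2': "G2 \<in> carrier_mat T r" using A G2 by (simp_all add: S)
  have X1_eq: "X1 = A * Z0 + B * U0 + E * D0"
    unfolding X1 Z0 U0 D0
    by (rule data_matrix_equation[OF A B E]) (use Zc x u d data in auto)
  have pd: "pos_def n P1" by (rule lmi_mat_pos_def_imp_pos_def[OF P1 Omega Delta E c(1) Y1 sdp3])
  note inv = pos_def_inverse[OF pd]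
  have G1c: "G1 \<in> carrier_mat T n" unfolding G1 by (rule mult_carrier_mat[OF Y1 inv(1)])
  have f_eq: "f v = (X1 - E * D0) *\<^sub>v (G1 *\<^sub>v v + G2 *\<^sub>v Q v)" if v: "v \<in> carrier_vec n" for v
    unfolding f Z K G1
    using closed_loop_eq[OF A' B E c(3,2,4) X1_eq pd Y1 G2' _ _ v, of "Q v"] sdp1 sdp2 Q' v
    by (auto simp: r_def)
  have ED: "E * D0 \<in> carrier_mat n T" by (rule mult_carrier_mat[OF E c(4)])
  have fc: "f \<in> carrier_vec n \<rightarrow> carrier_vec n"
  proof
    fix v :: rvec assume v: "v \<in> carrier_vec n"
    have Qv: "Q v \<in> carrier_vec r" using Q' v by auto
    have "G1 *\<^sub>v v + G2 *\<^sub>v Q v \<in> carrier_vec T"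
      by (rule add_carrier_vec[OF mult_mat_vec_carrier[OF G1c v] mult_mat_vec_carrier[OF G2' Qv]])
    then show "f v \<in> carrier_vec n"
      unfolding f_eq[OF v] by (rule mult_mat_vec_carrier[OF minus_carrier_mat[OF ED]])
  qed
  \<comment> \<open>The limit condition excludes the origin, so the equilibrium rests on
    \<open>Q_zero\<close>.\<close>
  have f0: "f (0\<^sub>v n) = 0\<^sub>v n"
    using f_eq[of "0\<^sub>v n"] Q_zero mult_mat_vec_zero[OF G1c] mult_mat_vec_zero[OF G2]
      mult_mat_vec_zero[OF minus_carrier_mat[OF ED, of X1]] by simp
  have lyap0: "lyap P1 (0\<^sub>v n) = 0" using inv(1) by (simp add: lyap_def mult_mat_vec_zero)
  obtain q where q: "0 \<le> q" "q < 1" and qV: "\<And>v. v \<in> carrier_vec n \<Longrightarrow> Q v \<in> carrier_vec r \<Longrightarrow>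
      lyap P1 ((X1 - E * D0) *\<^sub>v (G1 *\<^sub>v v + G2 *\<^sub>v Q v)) \<le> q * lyap P1 v + ell \<Omega> \<Delta> E X1 P1 G1 G2 Q v"
    using lyap_closed_loop_decrease[OF pd \<Omega>c Delta E c(1) Y1 c(4) G2' noise eps sdp3 G1] by blast
  \<comment> \<open>At the origin no sign of \<open>ell\<close> is at hand; both sides are 0
    there.\<close>
  have decr: "lyap P1 (f v) \<le> q * lyap P1 v"
    if v: "v \<in> carrier_vec n" and "v \<noteq> 0\<^sub>v n \<Longrightarrow> ell \<Omega> \<Delta> E X1 P1 G1 G2 Q v < 0" for v
  proof (cases "v = 0\<^sub>v n")
    case True
    then show ?thesis by (simp add: f0 lyap0)
  next
    case False
    then show ?thesis using qV[OF v] Q' v that(2) by (fastforce simp: f_eq)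
  qed
  obtain b where b: "0 < b" "\<And>v. v \<in> carrier_vec n \<Longrightarrow> b * (euclid_norm v)\<^sup>2 \<le> lyap P1 v"
    using pos_def_coercive[OF pos_def_minv[OF pd]] unfolding lyap_def euclid_norm_power2 by blast
  obtain C where C: "0 < C" "\<And>v. v \<in> carrier_vec n \<Longrightarrow> lyap P1 v \<le> C * (euclid_norm v)\<^sup>2"
    using quadratic_form_bounded[OF inv(1)] unfolding lyap_def euclid_norm_power2 by blast
  have V: "0 \<le> lyap P1 v" if "v \<in> carrier_vec n" for v
    using order_trans[OF _ b(2)[OF that], of 0] b(1) by simp
  obtain \<rho> where \<rho>: "0 < \<rho>" "\<And>v. v \<in> carrier_vec n \<Longrightarrow> v \<noteq> 0\<^sub>v n \<Longrightarrow> euclid_norm v < \<rho> \<Longrightarrow>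
      ell \<Omega> \<Delta> E X1 P1 G1 G2 Q v < 0"
    using ell_negative_near_zero[OF pd Omega c(1) E G1c G2' Q' Q_lim] by blast
  \<comment> \<open>Stability uses the ball of radius \<open>\<rho>\<close> on which
    \<open>ell\<close> is negative away from 0, independently of \<open>\<gamma>\<close>; this
    covers sublevel sets that are empty or contain the origin alone.\<close>
  have stable: "asymptotically_stable n f (0\<^sub>v n)"
    using asymptotically_stable_of_lyapunov[where V = "lyap P1", OF fc f0 b C q \<rho>(1)] decr \<rho>(2) by blast
  have "lyap P1 (f v) \<le> q * lyap P1 v" if "v \<in> carrier_vec n" "lyap P1 v \<le> \<gamma>" for v
    using decr[OF that(1)] sublevel that by blast
  \<comment> \<open>One estimate serves both claims: monotonicity of \<open>V\<close> along the
    orbit gives invariance, the geometric bound gives convergence.\<close>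
  then have orbit: "(f ^^ t) v \<in> carrier_vec n \<and> lyap P1 ((f ^^ t) v) \<le> q ^ t * lyap P1 v
      \<and> lyap P1 ((f ^^ t) v) \<le> lyap P1 v" if "v \<in> carrier_vec n" "lyap P1 v \<le> \<gamma>" for v t
    using funpow_sublevel[where V = "lyap P1", OF fc V q _ that] by blast
  have "solution_tendsto f v (0\<^sub>v n)" if "v \<in> carrier_vec n" "lyap P1 v \<le> \<gamma>" for v
    using solution_tendsto_of_geometric[where V = "lyap P1", OF b q] orbit[OF that] by blast
  moreover have "positively_invariant f {v \<in> carrier_vec n. lyap P1 v \<le> \<gamma>}"
    unfolding positively_invariant_def using orbit by (blast intro: order_trans)
  ultimately show ?thesis using stable unfolding region_of_attraction_def by blast
qed

end
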